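(* Let $n\ge 4$, $k>0$, let $\tilde R$ be a quiver on $[1,n-1]$ with $b_{ij}(\tilde R)\ge 2$ whenever $i<j$, and let $Q$ be the quiver on $[1,n]$ whose full subquiver on $[1,n-1]$ is obtained from $\tilde R$ by mutating successively at $2,1,2,1,\dots,2,1$ ($2k$ mutations, starting with $2$), and whose entries $b_{in}(Q)\ge 2$ ($1\le i\le n-1$) are arbitrary. Let $j_1,\dots,j_{n+4k}$ be the vertex sequence $$n,\ 1,2,\dots,1,2\ (2k\text{ terms}),\ n-1,n-2,\dots,2,1,\ 2,1,\dots,2,1\ (2k\text{ terms}),$$ let $Q^{(0)}=Q$ and $Q^{(m)}=\mu[j_m](Q^{(m-1)})$ for $1\le m\le n+4k$, and let $R=Q^{(2k+1)}$ (the quiver obtained from $Q$ by mutating at $n$ and then at $1,2,1,2,\dots,1,2$, $2k$ mutations). Suppose that either $n\ge 5$, or $n=4$ and $b_{14}(Q)\ne b_{23}(R)$. Then for any $0\le \ell<m\le n+4k-1$, the quiver $Q^{(\ell)}$ is not isomorphic to $Q^{(m)}$, nor to the quiver obtained from $Q^{(m)}$ by reversing all arrows; here isomorphism means equality after relabeling the vertices by a permutation.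
   Context: A quiver on $[1,n]$ is a finite directed multigraph with no loops and no oriented 2-cycles; quivers are labeled. It is encoded by the skew-symmetric matrix $B(Q)=(b_{ij})$, $b_{ij}>0$ meaning $b_{ij}$ arrows from $i$ to $j$. Mutation at $k$: $\mu[k](Q)$ has $b'_{ij}=-b_{ij}$ if $k\in\{i,j\}$ and $b'_{ij}=b_{ij}+\tfrac12(|b_{ik}|b_{kj}+b_{ik}|b_{kj}|)$ otherwise. *)

theory Defs
  imports Complex_Main "HOL-Combinatorics.Permutations"
begin

(* A quiver is encoded by its skew-symmetric integer matrix: B i j > 0 means B i j arrows from
   i to j (so loops and oriented 2-cycles are excluded). Entries outside the vertex set V are
   required to vanish, so that equality of labeled quivers on V is equality of functions. *)
type_synonym quiver = "nat \<Rightarrow> nat \<Rightarrow> int"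

definition quiver_on :: "nat set \<Rightarrow> quiver \<Rightarrow> bool" where
  "quiver_on V B \<longleftrightarrow> finite V \<and> (\<forall>i j. B i j = - B j i) \<and>
     (\<forall>i j. i \<notin> V \<or> j \<notin> V \<longrightarrow> B i j = 0)"

definition mutate :: "nat \<Rightarrow> quiver \<Rightarrow> quiver" where
  "mutate k B = (\<lambda>i j. if k = i \<or> k = j then - B i j
     else B i j + (\<bar>B i k\<bar> * B k j + B i k * \<bar>B k j\<bar>) div 2)"

(* The integer division by 2 in mutate is exact. *)
lemma even_mutate_term: "even (\<bar>a\<bar> * b + a * \<bar>b\<bar>)" for a b :: int
  by (cases "a \<ge> 0"; cases "b \<ge> 0") auto

lemma quiver_on_mutate:
  assumes "quiver_on V B" "k \<in> V"
  shows "quiver_on V (mutate k B)"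
proof -
  have skew: "B i j = - B j i" for i j
    using assms(1) unfolding quiver_on_def by blast
  have vanish: "B i j = 0" if "i \<notin> V \<or> j \<notin> V" for i j
    using assms(1) that unfolding quiver_on_def by blast
  have "mutate k B i j = - mutate k B j i" for i j
  proof -
    define t where "t = (\<bar>B j k\<bar> * B k i + B j k * \<bar>B k i\<bar>) div 2"
    have t2: "\<bar>B j k\<bar> * B k i + B j k * \<bar>B k i\<bar> = 2 * t"
      using even_mutate_term[of "B j k" "B k i"] unfolding t_def by simp
    have "\<bar>B i k\<bar> * B k j + B i k * \<bar>B k j\<bar> = 2 * (- t)"
      using t2 skew[of i k] skew[of k j] by (simp add: mult.commute)
    then have "(\<bar>B i k\<bar> * B k j + B i k * \<bar>B k j\<bar>) div 2 = - t"
      by simp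
    then show ?thesis
      using skew[of i j] unfolding mutate_def t_def by auto
  qed
  moreover have "mutate k B i j = 0" if "i \<notin> V \<or> j \<notin> V" for i j
  proof -
    have "B i j = 0" "\<bar>B i k\<bar> * B k j = 0" "B i k * \<bar>B k j\<bar> = 0"
      using vanish that by auto
    then show ?thesis unfolding mutate_def by auto
  qed
  ultimately show ?thesis
    using assms(1) unfolding quiver_on_def by blast
qed

(* The head of the list is the first vertex at which one mutates. *)
definition mutate_seq :: "nat list \<Rightarrow> quiver \<Rightarrow> quiver" where
  "mutate_seq vs B = fold mutate vs B"

definition full_subquiver :: "nat set \<Rightarrow> quiver \<Rightarrow> quiver" where
  "full_subquiver V B = (\<lambda>i j. if i \<in> V \<and> j \<in> V then B i j else 0)"

definition reverse_arrows :: "quiver \<Rightarrow> quiver" where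
  "reverse_arrows B = (\<lambda>i j. - B i j)"

definition isomorphic_on :: "nat set \<Rightarrow> quiver \<Rightarrow> quiver \<Rightarrow> bool" where
  "isomorphic_on V B C \<longleftrightarrow>
     (\<exists>\<pi>. \<pi> permutes V \<and> (\<forall>i\<in>V. \<forall>j\<in>V. C (\<pi> i) (\<pi> j) = B i j))"

(* n, (1,2)^k, n-1, ..., 1, (2,1)^k *)
definition vertex_seq :: "nat \<Rightarrow> nat \<Rightarrow> nat list" where
  "vertex_seq n k =
     [n] @ concat (replicate k [1, 2]) @ rev [1..<n] @ concat (replicate k [2, 1])"

definition quiver_at :: "nat \<Rightarrow> nat \<Rightarrow> quiver \<Rightarrow> nat \<Rightarrow> quiver" where
  "quiver_at n k Q m = mutate_seq (take m (vertex_seq n k)) Q"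

end

theory Submission
  imports Defs
begin

text \<open>Every quiver in the sequence can be written down explicitly. Mutating alternately at 1 and 2 makes the
  weights between \<open>{1, 2}\<close> and any other vertex j run through a linear recurrence
  \<open>x (m + 2) = b * x (m + 1) - x m\<close> with b the weight of the arrow between 1 and 2. Along the first half
  the solutions belonging to j = 3, ..., n - 1 descend to their initial terms while the one belonging
  to n ascends; after the sink mutations at n - 1, ..., 3 the directions are exchanged, and the weights
  a j between n and j have been replaced by larger ones A j.

  The quivers are told apart by their shape and their weights. Those before and in the middle have
  a source or a sink, the others do not. All others are 3-cycles in which vertices are replaced by
  sets of vertices; such a decomposition is nearly unique, so an isomorphism has to respect it, and
  comparing weights leaves only coincidences of two solutions of the recurrence at consecutive
  indices. These force n = 4 and equality of the initial terms, which is the excluded case.\<close>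

section \<open>Isomorphism up to reversal\<close>

text \<open>Why the directions are exchanged: on 1, ..., n-1 the block n-1, ..., 2, 1 mutates at a
  sink each time and so restores \<open>Rt\<close>; both halves therefore meet the same subquivers
  there. Only n notices the block: its arrows to j become arrows from j, with the paths through 2
  and through 1 added to them, and the pair \<open>T (2 * k)\<close>, \<open>T (Suc (2 * k))\<close>
  at n becomes \<open>T (2 * k - 2)\<close>, \<open>T (2 * k - 1)\<close>. One further mutation at 1
  would give back Q, so the indices run once round a closed cycle. Hence \<open>A j\<close> has one
  expression from each end of the cycle, and a Wronskian identity shows that they agree. The case n
  = 4 is special twice over: the set {3, ..., n-1} is a single vertex, which a reversal can exchange
  with n, and the decompositions with two large classes degenerate. Both lead to
  \<open>a 1 = d 3\<close>, which is the excluded equation because R agrees with \<open>Rt\<close>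
  on 1, 2, 3.\<close>

definition skew :: "quiver \<Rightarrow> bool" where
  "skew X \<longleftrightarrow> (\<forall>i j. X i j = - X j i)"

lemma skewD: "skew X \<Longrightarrow> X i j = - X j i"
  unfolding skew_def by blast

lemma skew_pos: "skew X \<Longrightarrow> X i j > 0 \<Longrightarrow> \<not> X j i > 0"
  using skewD[of X i j] by simp

lemma skew_irrefl: "skew X \<Longrightarrow> X i i = 0"
  using skewD[of X i i] by simp

lemma quiver_on_skew: "quiver_on V X \<Longrightarrow> skew X"
  unfolding quiver_on_def skew_def by blast

lemma mutate_row [simp]: "mutate k X k j = - X k j"
  and mutate_col [simp]: "mutate k X i k = - X i k"
  by (simp_all add: mutate_def)

text \<open>With \<open>mutate_in\<close> and \<open>mutate_out\<close> this removes the absolute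
  values and the division: an entry changes by the number of paths through k, and not at all if both
  arrows point to k or both away from it. The weak inequalities cover missing arrows.\<close>

lemma mutate_through:
  assumes "i \<noteq> k" "j \<noteq> k" "X i k \<ge> 0" "X k j \<ge> 0"
  shows "mutate k X i j = X i j + X i k * X k j"
  using assms by (simp add: mutate_def)

lemma mutate_in:
  assumes "skew X" "i \<noteq> k" "j \<noteq> k" "X i k \<ge> 0" "X j k \<ge> 0"
  shows "mutate k X i j = X i j"
  using assms skewD[of X k j] by (simp add: mutate_def)

lemma mutate_out:
  assumes "skew X" "i \<noteq> k" "j \<noteq> k" "X k i \<ge> 0" "X k j \<ge> 0"
  shows "mutate k X i j = X i j"
  using assms skewD[of X i k] by (simp add: mutate_def)

lemma skew_mutate:
  assumes "skew X"
  shows "skew (mutate k X)"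
  unfolding skew_def
proof (intro allI)
  fix i j
  define t where "t = (\<bar>X j k\<bar> * X k i + X j k * \<bar>X k i\<bar>) div 2"
  have t2: "\<bar>X j k\<bar> * X k i + X j k * \<bar>X k i\<bar> = 2 * t"
    using even_mutate_term[of "X j k" "X k i"] unfolding t_def by simp
  have "\<bar>X i k\<bar> * X k j + X i k * \<bar>X k j\<bar> = 2 * (- t)"
    using t2 skewD[OF assms, of i k] skewD[OF assms, of k j] by (simp add: mult.commute)
  then have "(\<bar>X i k\<bar> * X k j + X i k * \<bar>X k j\<bar>) div 2 = - t"
    by simp
  then show "mutate k X i j = - mutate k X j i"
    using skewD[OF assms, of i j] unfolding mutate_def t_def by auto
qed

text \<open>For a skew matrix this is the reversed quiver. Being a transpose and not a negation, it
  turns claims that entries are positive into claims of the same kind with the roles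
  exchanged.\<close>

definition opp :: "quiver \<Rightarrow> quiver" where
  "opp X = (\<lambda>i j. X j i)"

lemma opp_apply [simp]: "opp X i j = X j i"
  by (simp add: opp_def)

lemma skew_opp: "skew X \<Longrightarrow> skew (opp X)"
  unfolding skew_def opp_def by blast

definition iso_by :: "nat set \<Rightarrow> (nat \<Rightarrow> nat) \<Rightarrow> quiver \<Rightarrow> quiver \<Rightarrow> bool" where
  "iso_by V \<pi> X Y \<longleftrightarrow> \<pi> permutes V \<and> (\<forall>i\<in>V. \<forall>j\<in>V. Y (\<pi> i) (\<pi> j) = X i j)"

text \<open>The reversal sits on the side of X, so that every lemma on \<open>iso_by\<close> serves
  both cases, the second one with \<open>opp X\<close>.\<close>

definition similar :: "nat set \<Rightarrow> quiver \<Rightarrow> quiver \<Rightarrow> bool" where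
  "similar V X Y \<longleftrightarrow> (\<exists>\<pi>. iso_by V \<pi> X Y \<or> iso_by V \<pi> (opp X) Y)"

lemma similarE:
  assumes "similar V X Y"
  obtains \<pi> where "iso_by V \<pi> X Y" | \<pi> where "iso_by V \<pi> (opp X) Y"
  using assms unfolding similar_def by blast

lemma similar_if_isomorphic_on:
  assumes "skew Y"
    and "isomorphic_on V X Y \<or> isomorphic_on V X (reverse_arrows Y)"
  shows "similar V X Y"
proof -
  consider \<pi> where "\<pi> permutes V" "\<forall>i\<in>V. \<forall>j\<in>V. Y (\<pi> i) (\<pi> j) = X i j"
    | \<pi> where "\<pi> permutes V" "\<forall>i\<in>V. \<forall>j\<in>V. reverse_arrows Y (\<pi> i) (\<pi> j) = X i j"
    using assms(2) unfolding isomorphic_on_def by auto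
  then show ?thesis
  proof cases
    case (1 \<pi>)
    then have "iso_by V \<pi> X Y" unfolding iso_by_def by simp
    then show ?thesis unfolding similar_def by (intro exI disjI1)
  next
    case (2 \<pi>)
    have "Y (\<pi> i) (\<pi> j) = X j i" if "i \<in> V" "j \<in> V" for i j
      using 2(2) that skewD[OF assms(1), of "\<pi> i" "\<pi> j"] by (auto simp: reverse_arrows_def)
    then have "iso_by V \<pi> (opp X) Y" using 2(1) unfolding iso_by_def by simp
    then show ?thesis unfolding similar_def by (intro exI disjI2)
  qed
qed

context
  fixes V \<pi> X Y
  assumes iso: "iso_by V \<pi> X Y"
begin

lemma iso_by_permutes: "\<pi> permutes V"
  using iso unfolding iso_by_def by blast

lemma iso_by_eq: "i \<in> V \<Longrightarrow> j \<in> V \<Longrightarrow> Y (\<pi> i) (\<pi> j) = X i j"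
  using iso unfolding iso_by_def by blast

lemma iso_by_mem: "i \<in> V \<Longrightarrow> \<pi> i \<in> V"
  using permutes_in_image[OF iso_by_permutes] by blast

lemma iso_by_inj: "\<pi> i = \<pi> j \<longleftrightarrow> i = j"
  using permutes_inj[OF iso_by_permutes] by (simp add: inj_eq)

lemma iso_by_card: "card (\<pi> ` A) = card A"
  by (rule card_image[OF permutes_inj_on[OF iso_by_permutes]])

lemma iso_by_surj:
  assumes "v \<in> V" obtains i where "i \<in> V" "\<pi> i = v"
proof -
  have "v \<in> \<pi> ` V" using assms permutes_image[OF iso_by_permutes] by simp
  then show ?thesis using that by auto
qed

end

section \<open>Sources and sinks as an invariant\<close>

definition inner_vertex :: "nat set \<Rightarrow> quiver \<Rightarrow> nat \<Rightarrow> bool" where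
  "inner_vertex V X v \<longleftrightarrow> (\<exists>x\<in>V. X v x > 0) \<and> (\<exists>x\<in>V. X x v > 0)"

lemma inner_vertex_opp [simp]: "inner_vertex V (opp X) v = inner_vertex V X v"
  unfolding inner_vertex_def by auto

lemma iso_by_inner_vertex:
  assumes iso: "iso_by V \<pi> X Y" and "v \<in> V" "inner_vertex V Y (\<pi> v)"
  shows "inner_vertex V X v"
proof -
  obtain x y where xy: "x \<in> V" "Y (\<pi> v) x > 0" "y \<in> V" "Y y (\<pi> v) > 0"
    using assms(3) unfolding inner_vertex_def by blast
  obtain x' where "x' \<in> V" "\<pi> x' = x" using iso_by_surj[OF iso xy(1)] .
  moreover obtain y' where "y' \<in> V" "\<pi> y' = y" using iso_by_surj[OF iso xy(3)] .
  ultimately show ?thesis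
    unfolding inner_vertex_def
    using xy iso_by_eq[OF iso \<open>v \<in> V\<close>, of x'] iso_by_eq[OF iso _ \<open>v \<in> V\<close>, of y'] by metis
qed

lemma similar_inner_vertices:
  assumes "similar V X Y" "\<forall>v\<in>V. inner_vertex V Y v" "v \<in> V"
  shows "inner_vertex V X v"
  using assms(1)
proof (cases rule: similarE)
  case (1 \<pi>)
  then show ?thesis using iso_by_inner_vertex[OF 1] iso_by_mem[OF 1] assms by blast
next
  case (2 \<pi>)
  then show ?thesis using iso_by_inner_vertex[OF 2] iso_by_mem[OF 2] assms by simp
qed

lemma similar_sym:
  assumes "similar V X Y" shows "similar V Y X"
proof -
  have *: "iso_by V (inv \<pi>) Y X" if iso: "iso_by V \<pi> X Y" for \<pi> X Y
    unfolding iso_by_def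
    using permutes_inv[OF iso_by_permutes[OF iso]] iso_by_eq[OF iso]
      permutes_inverses(1)[OF iso_by_permutes[OF iso]] permutes_in_image
    by metis
  from assms show ?thesis
  proof (cases rule: similarE)
    case (1 \<pi>)
    then show ?thesis using * unfolding similar_def by blast
  next
    case (2 \<pi>)
    from *[OF 2] have "iso_by V (inv \<pi>) (opp Y) X"
      unfolding iso_by_def by simp
    then show ?thesis unfolding similar_def by blast
  qed
qed

section \<open>Blown-up 3-cycles and their uniqueness\<close>

text \<open>The 3-cycle v -> A -> B -> v with two corners replaced by sets; the arrows inside A and
  inside B are arbitrary.\<close>

definition tri :: "nat set \<Rightarrow> quiver \<Rightarrow> nat \<Rightarrow> nat set \<Rightarrow> nat set \<Rightarrow> bool" where
  "tri V X v A B \<longleftrightarrow> V = insert v (A \<union> B) \<and> A \<noteq> {} \<and> B \<noteq> {} \<and>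
     (\<forall>x\<in>A. X v x > 0) \<and> (\<forall>y\<in>B. X y v > 0) \<and> (\<forall>x\<in>A. \<forall>y\<in>B. X x y > 0)"

lemma tri_opp: "tri V X v A B \<Longrightarrow> tri V (opp X) v B A"
  unfolding tri_def by auto

lemma tri_inner_vertex:
  assumes "tri V X v A B" "e \<in> V"
  shows "inner_vertex V X e"
  using assms unfolding tri_def inner_vertex_def by blast

lemma iso_by_tri:
  assumes iso: "iso_by V \<pi> X Y" and tri: "tri V X v A B"
  shows "tri V Y (\<pi> v) (\<pi> ` A) (\<pi> ` B)"
proof -
  have V: "V = insert v (A \<union> B)" using tri unfolding tri_def by blast
  have "V = \<pi> ` V" using permutes_image[OF iso_by_permutes[OF iso]] by simp
  also have "\<dots> = insert (\<pi> v) (\<pi> ` A \<union> \<pi> ` B)" by (subst V) blast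
  finally have V': "V = insert (\<pi> v) (\<pi> ` A \<union> \<pi> ` B)" .
  have eq: "Y (\<pi> i) (\<pi> j) = X i j" if "i \<in> insert v (A \<union> B)" "j \<in> insert v (A \<union> B)" for i j
    using iso_by_eq[OF iso] that V by blast
  show ?thesis
    unfolding tri_def
    using tri V' eq unfolding tri_def by auto
qed

text \<open>A and B are the out-neighbours and the in-neighbours of v, so a second decomposition has
  to have another centre.\<close>

lemma tri_out_eq:
  assumes "skew X" "tri V X v A B" "tri V X v A' B'"
  shows "A = A'" "B = B'"
proof -
  have *: "A = {x \<in> V. X v x > 0}" "B = {x \<in> V. X x v > 0}"
    if "tri V X v A B" for A B
    using that skew_pos[OF assms(1)] skew_irrefl[OF assms(1), of v] unfolding tri_def by auto
  show "A = A'" "B = B'"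
    using *[OF assms(2)] *[OF assms(3)] by auto
qed

text \<open>Let \<open>v'\<close> lie in A; the case of B is this one for \<open>opp X\<close>. Then
  v lies in \<open>B'\<close> and all of B in \<open>A'\<close>. A second element of A can be
  neither in \<open>A'\<close>, as it would then point to v, nor in \<open>B'\<close>, as it would
  then receive arrows from B. So A is \<open>{v'}\<close>, and only v is left for
  \<open>B'\<close>.\<close>

lemma tri_unique:
  assumes sk: "skew X" and "tri V X v A B" "tri V X v' A' B'" "v \<noteq> v'"
  shows "A = {v'} \<and> B' = {v} \<or> B = {v'} \<and> A' = {v}"
proof -
  have main: "A = {v'} \<and> B' = {v}"
    if sk: "skew X" and 1: "tri V X v A B" and 2: "tri V X v' A' B'" and v': "v' \<in> A" for X A B A' B'
  proof -
    note asym = skew_pos[OF sk]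
    have V: "insert v (A \<union> B) = insert v' (A' \<union> B')"
      using 1 2 unfolding tri_def by blast
    have ne: "v \<noteq> v'" using v' 1 skew_irrefl[OF sk, of v] unfolding tri_def by force
    have vB': "v \<in> B'"
      using V ne 1 2 v' asym unfolding tri_def by (metis Un_iff insert_iff)
    have B: "B \<subseteq> A'"
    proof
      fix y assume y: "y \<in> B"
      then have "X v' y > 0" using 1 v' unfolding tri_def by blast
      moreover from this have "y \<noteq> v'" using skew_irrefl[OF sk, of v'] by auto
      ultimately show "y \<in> A'"
        using V y 2 asym unfolding tri_def by (metis Un_iff insert_iff)
    qed
    have A: "A = {v'}"
    proof (rule ccontr)
      assume "A \<noteq> {v'}"
      then obtain x where x: "x \<in> A" "x \<noteq> v'" using v' by blast
      have "x \<notin> A'"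
        using 1 2 x(1) vB' asym[of v x] unfolding tri_def by auto
      then have "x \<in> B'" using x V by blast
      moreover obtain y where y: "y \<in> B" using 1 unfolding tri_def by blast
      ultimately have "X y x > 0" "X x y > 0"
        using 1 2 x(1) B unfolding tri_def by auto
      then show False using asym by blast
    qed
    have "B' \<subseteq> {v}"
    proof
      fix z assume z: "z \<in> B'"
      then have "z \<noteq> v'" using 2 skew_irrefl[OF sk, of v'] unfolding tri_def by force
      moreover have "z \<notin> B"
      proof
        assume "z \<in> B"
        then have "X v' z > 0" "X z v' > 0" using z B 2 unfolding tri_def by auto
        then show False using asym by blast
      qed
      moreover have "z \<in> insert v (A \<union> B)" using V z by blast
      ultimately show "z \<in> {v}" using A by blast
    qed
    then show ?thesis using A vB' by blast
  qed
  have "v' \<in> insert v (A \<union> B)" using assms(2,3) unfolding tri_def by blast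
  then have "v' \<in> A \<or> v' \<in> B" using assms(4) by blast
  then show ?thesis
    using main[OF sk assms(2,3)] main[OF skew_opp[OF sk] tri_opp[OF assms(2)] tri_opp[OF assms(3)]]
    by blast
qed

text \<open>The ambiguity in \<open>tri_unique\<close> makes A or B a singleton. No size is asked of
  \<open>A'\<close> and \<open>B'\<close>, so the lemma also compares with the decomposition given
  by a hub.\<close>

lemma tri_wide_unique:
  assumes "skew X" "tri V X v A B" "tri V X v' A' B'" "card A \<ge> 2" "card B \<ge> 2"
  shows "v' = v" "A' = A" "B' = B"
proof -
  show "v' = v" using tri_unique[OF assms(1-3)] assms(4,5) by force
  then show "A' = A" "B' = B" using tri_out_eq[OF assms(1,2)] assms(3) by blast+
qed

section \<open>Hubs: the decompositions with an ambiguous centre\<close>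

text \<open>Both p, with classes {q} and the rest, and q, with classes the rest and {p}, give a
  \<open>tri\<close>. The arrow from p to q is canonical all the same, and its weight is an
  invariant.\<close>

definition hub :: "nat set \<Rightarrow> quiver \<Rightarrow> nat \<Rightarrow> nat \<Rightarrow> bool" where
  "hub V X p q \<longleftrightarrow> p \<in> V \<and> q \<in> V \<and> p \<noteq> q \<and> X p q > 0 \<and> (\<forall>z\<in>V - {p,q}. X q z > 0 \<and> X z p > 0)"

lemma hub_opp: "hub V X p q \<Longrightarrow> hub V (opp X) q p"
  unfolding hub_def by auto

lemma hub_tri:
  assumes "hub V X p q" "card V \<ge> 4"
  shows "tri V X p {q} (V - {p,q})" "card (V - {p,q}) \<ge> 2"
proof -
  have "card (V - {p,q}) = card V - 2"
    using assms unfolding hub_def by (subst card_Diff_subset) auto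
  then show c: "card (V - {p,q}) \<ge> 2" using assms by simp
  then have "V - {p,q} \<noteq> {}" by force
  then show "tri V X p {q} (V - {p,q})"
    using assms unfolding hub_def tri_def by auto
qed

lemma hub_inner_vertex:
  assumes "hub V X p q" "card V \<ge> 4" "v \<in> V"
  shows "inner_vertex V X v"
  using tri_inner_vertex[OF hub_tri(1)[OF assms(1,2)] assms(3)] .

text \<open>In an oriented 3-cycle every arrow is a hub, hence four vertices: then the remaining
  vertices number at least two, which refutes both alternatives of
  \<open>tri_unique\<close>.\<close>

lemma hub_unique:
  assumes sk: "skew X" and "card V \<ge> 4" "hub V X p q" "hub V X p' q'"
  shows "p' = p \<and> q' = q"
proof -
  note t = hub_tri[OF assms(3,2)] and t' = hub_tri[OF assms(4,2)]
  have "p' = p"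
    using tri_unique[OF sk t(1) t'(1)] t(2) t'(2) by force
  then show ?thesis using tri_out_eq[OF sk t(1)] t'(1) by blast
qed

lemma iso_by_hub:
  assumes iso: "iso_by V \<pi> X Y" and "hub V X p q"
  shows "hub V Y (\<pi> p) (\<pi> q)"
proof -
  have "Y (\<pi> q) z > 0 \<and> Y z (\<pi> p) > 0" if z: "z \<in> V - {\<pi> p, \<pi> q}" for z
  proof -
    from z have "z \<in> V" by simp
    then obtain z' where z': "z' \<in> V" "\<pi> z' = z" by (rule iso_by_surj[OF iso])
    then have "z' \<in> V - {p, q}" using z by auto
    then have "X q z' > 0" "X z' p > 0" "p \<in> V" "q \<in> V" using assms(2) unfolding hub_def by blast+
    then show ?thesis
      using iso_by_eq[OF iso, of q z'] iso_by_eq[OF iso, of z' p] z' by simp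
  qed
  moreover have "p \<in> V" "q \<in> V" "p \<noteq> q" "X p q > 0"
    using assms(2) unfolding hub_def by blast+
  ultimately show ?thesis
    using iso_by_eq[OF iso, of p q] iso_by_mem[OF iso] iso_by_inj[OF iso, of p q]
    unfolding hub_def by simp
qed

lemma iso_by_hub_eq:
  assumes "iso_by V \<pi> X Y" "skew Y" "card V \<ge> 4" "hub V X p q" "hub V Y p' q'"
  shows "\<pi> p = p'" "\<pi> q = q'"
  using hub_unique[OF assms(2,3,5) iso_by_hub[OF assms(1,4)]] by simp_all

lemma hub_not_wide_tri:
  assumes "similar V X Y" "skew Y" "card V \<ge> 4" "hub V X p q"
    "tri V Y v A B" "card A \<ge> 2" "card B \<ge> 2"
  shows False
  using assms(1)
proof (cases rule: similarE)
  case (1 \<pi>)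
  have "tri V Y (\<pi> p) (\<pi> ` {q}) (\<pi> ` (V - {p,q}))"
    using iso_by_tri[OF 1 hub_tri(1)[OF assms(4,3)]] .
  from tri_wide_unique(2)[OF assms(2,5) this assms(6,7)] have "card A = 1" by auto
  then show ?thesis using assms(6) by simp
next
  case (2 \<pi>)
  have "tri V Y (\<pi> p) (\<pi> ` (V - {p,q})) (\<pi> ` {q})"
    using iso_by_tri[OF 2 tri_opp[OF hub_tri(1)[OF assms(4,3)]]] .
  from tri_wide_unique(3)[OF assms(2,5) this assms(6,7)] have "card B = 1" by auto
  then show ?thesis using assms(7) by simp
qed

lemma similar_hub_weight:
  assumes "similar V X Y" "skew Y" "card V \<ge> 4" "hub V X p q" "hub V Y p' q'"
  shows "Y p' q' = X p q"
  using assms(1)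
proof (cases rule: similarE)
  case (1 \<pi>)
  then show ?thesis
    using iso_by_hub_eq[OF 1 assms(2-5)] iso_by_eq[OF 1, of p q] assms(4) unfolding hub_def by simp
next
  case (2 \<pi>)
  then show ?thesis
    using iso_by_hub_eq[OF 2 assms(2,3) hub_opp[OF assms(4)] assms(5)] iso_by_eq[OF 2, of q p] assms(4)
    unfolding hub_def by simp
qed

text \<open>The hub is preserved, and the direction of the arrow between the two other vertices
  leaves one possible map for an isomorphism and one for a reversal. The second alternative is the
  reversal, which sends x to \<open>y'\<close> and y to \<open>x'\<close>.\<close>

lemma similar_hub_four:
  assumes "similar V X Y" "skew X" "skew Y" "card V = 4"
    and X: "hub V X p q" "V = {p,q,x,y}" "X x y > 0"
    and Y: "hub V Y p' q'" "V = {p',q',x',y'}" "Y x' y' > 0"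
  shows "Y x' y' = X x y \<and>
    (Y x' p' = X x p \<and> Y y' p' = X y p \<and> Y q' x' = X q x \<and> Y q' y' = X q y \<or>
     Y x' p' = X q y \<and> Y y' p' = X q x \<and> Y q' x' = X y p \<and> Y q' y' = X x p)"
proof -
  have "card (set [p,q,x,y]) = 4" "card (set [p',q',x',y']) = 4"
    using assms(4) X(2) Y(2) by (metis list.set)+
  then have dist: "distinct [p,q,x,y]" "distinct [p',q',x',y']"
    using card_distinct[of "[p,q,x,y]"] card_distinct[of "[p',q',x',y']"] by simp_all
  have V: "x \<in> V" "y \<in> V" using X(2) by auto
  from assms(1) show ?thesis
  proof (cases rule: similarE)
    case (1 \<pi>)
    have \<pi>: "\<pi> p = p'" "\<pi> q = q'"
      using iso_by_hub_eq[OF 1 assms(3) _ X(1) Y(1)] assms(4) by auto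
    have eq: "\<And>i j. i \<in> {p,q,x,y} \<Longrightarrow> j \<in> {p,q,x,y} \<Longrightarrow> Y (\<pi> i) (\<pi> j) = X i j"
      unfolding X(2)[symmetric] using iso_by_eq[OF 1] .
    have "\<pi> x \<in> {p',q',x',y'}" "\<pi> y \<in> {p',q',x',y'}"
      using iso_by_mem[OF 1 V(1)] iso_by_mem[OF 1 V(2)] unfolding Y(2) by blast+
    then have "\<pi> x \<in> {x',y'}" "\<pi> y \<in> {x',y'}" "\<pi> x \<noteq> \<pi> y"
      using dist(1) iso_by_inj[OF 1, of x p] iso_by_inj[OF 1, of x q] iso_by_inj[OF 1, of x y]
        iso_by_inj[OF 1, of y p] iso_by_inj[OF 1, of y q] \<pi> by auto
    moreover have "Y (\<pi> x) (\<pi> y) > 0" using eq X(3) by simp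
    ultimately have xy: "\<pi> x = x'" "\<pi> y = y'" using Y(3) skew_pos[OF assms(3), of x' y'] by auto
    show ?thesis
      using eq[of x y] eq[of x p] eq[of y p] eq[of q x] eq[of q y] \<pi> xy by simp
  next
    case (2 \<pi>)
    have \<pi>: "\<pi> p = q'" "\<pi> q = p'"
      using iso_by_hub_eq[OF 2 assms(3) _ hub_opp[OF X(1)] Y(1)] assms(4) by auto
    have eq: "\<And>i j. i \<in> {p,q,x,y} \<Longrightarrow> j \<in> {p,q,x,y} \<Longrightarrow> Y (\<pi> i) (\<pi> j) = X j i"
      unfolding X(2)[symmetric] using iso_by_eq[OF 2] by simp
    have "\<pi> x \<in> {p',q',x',y'}" "\<pi> y \<in> {p',q',x',y'}"
      using iso_by_mem[OF 2 V(1)] iso_by_mem[OF 2 V(2)] unfolding Y(2) by blast+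
    then have "\<pi> x \<in> {x',y'}" "\<pi> y \<in> {x',y'}" "\<pi> x \<noteq> \<pi> y"
      using dist(1) iso_by_inj[OF 2, of x p] iso_by_inj[OF 2, of x q] iso_by_inj[OF 2, of x y]
        iso_by_inj[OF 2, of y p] iso_by_inj[OF 2, of y q] \<pi> by auto
    moreover have "Y (\<pi> y) (\<pi> x) > 0" using eq X(3) by simp
    ultimately have xy: "\<pi> x = y'" "\<pi> y = x'" using Y(3) skew_pos[OF assms(3), of x' y'] by auto
    show ?thesis
      using eq[of y x] eq[of p x] eq[of p y] eq[of x q] eq[of y q] \<pi> xy by simp
  qed
qed

section \<open>The linear recurrence\<close>

fun lrec :: "int \<Rightarrow> int \<Rightarrow> int \<Rightarrow> nat \<Rightarrow> int" where
  "lrec b u v 0 = u"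
| "lrec b u v (Suc 0) = v"
| "lrec b u v (Suc (Suc m)) = b * lrec b u v (Suc m) - lrec b u v m"

text \<open>Positivity is what allows b to be replaced by 2, and growth then gives
  \<open>2 * f (Suc m) - f m > f (Suc m)\<close>; so the induction carries both.\<close>

lemma lrec_growth:
  assumes "b \<ge> 2" "u < 0" "v > 0"
  shows "lrec b u v m < lrec b u v (Suc m) \<and> lrec b u v (Suc m) > 0"
proof (induction m)
  case (Suc m)
  let ?f = "lrec b u v"
  have "2 * ?f (Suc m) \<le> b * ?f (Suc m)"
    using assms(1) Suc by (intro mult_right_mono) auto
  then show ?case using Suc unfolding lrec.simps by linarith
qed (use assms in simp)

lemma lrec_strict_mono:
  assumes "b \<ge> 2" "u < 0" "v > 0"
  shows "strict_mono (lrec b u v)"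
  using lrec_growth[OF assms] by (simp add: strict_mono_Suc_iff)

lemma lrec_pos:
  assumes "b \<ge> 2" "u < 0" "v > 0" "m \<ge> 1"
  shows "lrec b u v m > 0"
  using lrec_growth[OF assms(1-3), of "m - 1"] assms(4) by simp

text \<open>Already term 2 is \<open>b * v - u\<close> with u negative. This makes arrows of weight
  b recognisable among the others.\<close>

lemma lrec_gt_coeff:
  assumes "b \<ge> 2" "u < 0" "v > 0" "m \<ge> 2"
  shows "lrec b u v m > b"
proof -
  have "b * 1 \<le> b * v" using assms by (intro mult_left_mono) auto
  then have "b < lrec b u v (Suc (Suc 0))" using assms(2) unfolding lrec.simps by linarith
  also have "\<dots> \<le> lrec b u v m"
    using strict_mono_leD[OF lrec_strict_mono[OF assms(1-3)], of 2 m] assms(4)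
    by (simp add: numeral_2_eq_2)
  finally show ?thesis .
qed

text \<open>Two solutions of the recurrence that agree on a pair of consecutive terms agree all the way
  down, and since only the initial terms are negative the indices must agree as well.\<close>
lemma lrec_match:
  assumes "b \<ge> 2" "u < 0" "v > 0" "u' < 0" "v' > 0"
    and "lrec b u v i = lrec b u' v' j" "lrec b u v (Suc i) = lrec b u' v' (Suc j)"
  shows "v = v'"
  using assms(6,7)
proof (induction i arbitrary: j)
  case 0
  have "lrec b u' v' j < 0" using 0 assms by simp
  then have "j = 0" using lrec_pos[OF assms(1,4,5), of j] by (cases j) auto
  then show ?case using 0 by simp
next
  case (Suc i)
  have "lrec b u' v' j > 0" using Suc.prems(1) lrec_pos[OF assms(1-3), of "Suc i"] by simp
  then obtain j' where j: "j = Suc j'" using assms(4) by (cases j) auto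
  show ?case using Suc.IH[of j'] Suc.prems unfolding j by simp
qed

text \<open>By the recurrence the left-hand side depends only on i + j; the right-hand side is its
  value when the whole index is moved to the second solution.\<close>

lemma lrec_wronskian:
  "lrec b u v (Suc i) * lrec b u' v' (Suc j) - lrec b u v i * lrec b u' v' j =
   v * lrec b u' v' (Suc (i + j)) - u * lrec b u' v' (i + j)"
proof (induction i arbitrary: j)
  case (Suc i)
  show ?case using Suc[of "Suc j"] by (simp add: algebra_simps)
qed simp

section \<open>The quivers of the mutation sequence\<close>

lemma length_concat_replicate: "length (concat (replicate k [x, y])) = 2 * k"
  by (induction k) auto

lemma nth_concat_replicate:
  "m < 2 * k \<Longrightarrow> concat (replicate k [x, y]) ! m = (if even m then x else y)"
proof (induction k arbitrary: m)
  case (Suc k)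
  then show ?case
    by (cases m; cases "m - 1") (auto simp: nth_Cons split: nat.splits)
qed simp

lemma length_vertex_seq: "n \<ge> 1 \<Longrightarrow> length (vertex_seq n k) = n + 4 * k"
  by (simp add: vertex_seq_def length_concat_replicate)

text \<open>The descending block is indexed as a whole: its last two entries 2 and 1, at r = n - 3
  and r = n - 2, form the turn between the two halves.\<close>

lemma vertex_seq_nth:
  shows "vertex_seq n k ! 0 = n"
    and "t < 2 * k \<Longrightarrow> vertex_seq n k ! Suc t = (if even t then 1 else 2)"
    and "r < n - 1 \<Longrightarrow> vertex_seq n k ! (2 * k + 1 + r) = n - 1 - r"
    and "i < 2 * k \<Longrightarrow> n \<ge> 1 \<Longrightarrow> vertex_seq n k ! (2 * k + n + i) = (if even i then 2 else 1)"
proof -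
  let ?c = "\<lambda>x y. concat (replicate k [x, y :: nat])"
  have v: "vertex_seq n k = n # ?c 1 2 @ rev [1..<n] @ ?c 2 1"
    by (simp add: vertex_seq_def)
  note [simp] = length_concat_replicate nth_concat_replicate
  show "vertex_seq n k ! 0 = n" by (simp add: v)
  show "vertex_seq n k ! Suc t = (if even t then 1 else 2)" if "t < 2 * k"
    using that by (simp add: v nth_append)
  show "vertex_seq n k ! (2 * k + 1 + r) = n - 1 - r" if "r < n - 1"
    using that by (simp add: v nth_append rev_nth)
  show "vertex_seq n k ! (2 * k + n + i) = (if even i then 2 else 1)" if "i < 2 * k" "n \<ge> 1"
  proof -
    let ?xs = "n # ?c 1 2 @ rev [1..<n]"
    have "length ?xs = 2 * k + n" using that(2) by simp
    then have "vertex_seq n k ! (2 * k + n + i) = ?c 2 1 ! i"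
      using nth_append_length_plus[of ?xs "?c 2 1" i] by (simp add: v del: nth_concat_replicate)
    then show ?thesis using that(1) by simp
  qed
qed

lemma quiver_at_0: "quiver_at n k Q 0 = Q"
  by (simp add: quiver_at_def mutate_seq_def)

lemma quiver_at_Suc:
  assumes "m < n + 4 * k" "n \<ge> 1"
  shows "quiver_at n k Q (Suc m) = mutate (vertex_seq n k ! m) (quiver_at n k Q m)"
  using assms length_vertex_seq[of n k]
  by (simp add: quiver_at_def mutate_seq_def take_Suc_conv_app_nth)

lemma concat_replicate_Suc: "concat (replicate (Suc m) xs) = concat (replicate m xs) @ xs"
  by (induction m) auto

section \<open>Parameters and weights\<close>

text \<open>For i, j in {3..<n} the letters b, c, d, w stand for the entries \<open>Rt 1 2\<close>,
  \<open>Rt 1 j\<close>, \<open>Rt 2 j\<close>, \<open>Rt i j\<close>, and \<open>a i\<close> stands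
  for \<open>Q i n\<close>. All quivers of the sequence are expressed in these numbers.\<close>

locale cycle_data =
  fixes n k :: nat and b :: int and c d a :: "nat \<Rightarrow> int" and w :: quiver
  assumes n4: "n \<ge> 4" and k1: "k \<ge> 1" and b2: "b \<ge> 2"
    and c2: "\<And>j. j \<in> {3..<n} \<Longrightarrow> c j \<ge> 2"
    and d2: "\<And>j. j \<in> {3..<n} \<Longrightarrow> d j \<ge> 2"
    and a2: "\<And>i. i \<in> {1..<n} \<Longrightarrow> a i \<ge> 2"
    and skew_w: "skew w"
    and w2: "\<And>i j. 3 \<le> i \<Longrightarrow> i < j \<Longrightarrow> j < n \<Longrightarrow> w i j \<ge> 2"
begin

abbreviation "V \<equiv> {1..n}"

definition J :: "nat set" where
  "J = {3..<n}"

text \<open>Weights are read along q -> j -> p, while \<open>Rt\<close> has arrows from 1 to j;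
  hence the negative term 0. With this sign \<open>Rt\<close> is itself a \<open>fork\<close>, at x
  = 0.\<close>

definition S :: "nat \<Rightarrow> nat \<Rightarrow> int" where
  "S j = lrec b (- c j) (d j)"

text \<open>After the mutation at n there are \<open>a 2\<close> arrows from n to 2 and
  \<open>a 1\<close> from n to 1; read along 2 -> n -> 1 these are the two initial terms.\<close>

definition T :: "nat \<Rightarrow> int" where
  "T = lrec b (- a 2) (a 1)"

lemma a_pos: "i \<in> {1..<n} \<Longrightarrow> a i > 0"
  using a2[of i] by simp

lemma a12: "a 1 \<ge> 2" "a 2 \<ge> 2"
  using a2[of 1] a2[of 2] n4 by auto

lemma J_range: "j \<in> J \<Longrightarrow> 3 \<le> j \<and> j < n"
  by (simp add: J_def)

lemma aJ: "j \<in> J \<Longrightarrow> a j \<ge> 2"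
  using a2[of j] by (simp add: J_def)

lemma cJ: "j \<in> J \<Longrightarrow> c j \<ge> 2" and dJ: "j \<in> J \<Longrightarrow> d j \<ge> 2"
  using c2 d2 by (simp_all add: J_def)

lemma V_eq: "V = insert 1 (insert 2 (insert n J))"
  using n4 by (auto simp: J_def)

lemma V_cases:
  assumes "i \<in> V" obtains "i = 1" | "i = 2" | "i = n" | "i \<in> J"
  using assms unfolding J_def by fastforce

lemma V_mem: "1 \<in> V" "2 \<in> V" "n \<in> V" "j \<in> J \<Longrightarrow> j \<in> V"
  using n4 unfolding J_def by auto

lemma J_four: "n = 4 \<Longrightarrow> J = {3}"
  unfolding J_def by auto

lemma three_J: "3 \<in> J"
  using n4 by (simp add: J_def)

lemma finite_J: "finite J"
  by (simp add: J_def)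

lemma card_J: "card J = n - 3"
  by (simp add: J_def)

lemma S_0: "S j 0 = - c j" and S_1: "S j (Suc 0) = d j"
  and S_rec: "S j (Suc (Suc m)) = b * S j (Suc m) - S j m"
  by (simp_all add: S_def)

lemma T_0: "T 0 = - a 2" and T_1: "T (Suc 0) = a 1"
  and T_rec: "T (Suc (Suc m)) = b * T (Suc m) - T m"
  by (simp_all add: T_def)

context
  fixes j assumes j: "j \<in> J"
begin

lemma S_pos: "m \<ge> 1 \<Longrightarrow> S j m > 0"
  unfolding S_def using lrec_pos[of b] b2 cJ[OF j] dJ[OF j] by simp

lemma S_gt_b: "m \<ge> 2 \<Longrightarrow> S j m > b"
  unfolding S_def using lrec_gt_coeff[of b] b2 cJ[OF j] dJ[OF j] by simp

lemma S_mono: "S j m < S j m' \<longleftrightarrow> m < m'"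
  unfolding S_def using lrec_strict_mono[of b] b2 cJ[OF j] dJ[OF j] by (simp add: strict_mono_less)

lemma S_eq: "S j m = S j m' \<longleftrightarrow> m = m'"
  unfolding S_def using lrec_strict_mono[of b] b2 cJ[OF j] dJ[OF j] by (simp add: strict_mono_eq)

end

lemma T_pos: "m \<ge> 1 \<Longrightarrow> T m > 0"
  unfolding T_def using lrec_pos[of b] b2 a12 by simp

lemma T_gt_b: "m \<ge> 2 \<Longrightarrow> T m > b"
  unfolding T_def using lrec_gt_coeff[of b] b2 a12 by simp

lemma T_mono: "T m < T m' \<longleftrightarrow> m < m'"
  unfolding T_def using lrec_strict_mono[of b] b2 a12 by (simp add: strict_mono_less)

lemma T_eq: "T m = T m' \<longleftrightarrow> m = m'"
  unfolding T_def using lrec_strict_mono[of b] b2 a12 by (simp add: strict_mono_eq)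

lemma T_gt_a2: "m \<ge> 2 \<Longrightarrow> T m > a 2"
proof -
  assume "m \<ge> 2"
  then have "T 2 \<le> T m" using T_mono[of m 2] by linarith
  moreover have "T 2 = b * a 1 + a 2" using T_rec[of 0] by (simp add: T_0 T_1 numeral_2_eq_2)
  moreover have "b * a 1 > 0" using b2 a12 by simp
  ultimately show ?thesis by linarith
qed

text \<open>The old arrows between n and j, together with the paths j -> 2 -> n and j -> 1 -> n that
  arise when the descending block ends with 2, 1.\<close>

definition A :: "nat \<Rightarrow> int" where
  "A j = a j + d j * T (2 * k) + c j * T (2 * k - 1)"

text \<open>The Wronskian identity at the indices \<open>2 * k - 1\<close> and 0. This form is
  needed at the end of the cycle, where T has descended to \<open>a 1\<close> and
  \<open>a 2\<close>.\<close>

lemma A_eq: "A j = a j + a 1 * S j (2 * k) + a 2 * S j (2 * k - 1)"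
proof -
  obtain m where m: "2 * k = Suc m" using k1 by (cases "2 * k") auto
  show ?thesis
    using lrec_wronskian[of b "- c j" "d j" m "- a 2" "a 1" 0]
    unfolding A_def m by (simp add: S_def T_def algebra_simps)
qed

context
  fixes j assumes j: "j \<in> J"
begin

lemma A_gt_a: "A j > a j"
proof -
  have "d j * T (2 * k) > 0" "c j * T (2 * k - 1) > 0"
    using T_pos[of "2 * k"] T_pos[of "2 * k - 1"] k1 cJ[OF j] dJ[OF j] by simp_all
  then show ?thesis unfolding A_def by simp
qed

lemma A_gt_T: "A j > T (2 * k)"
proof -
  have "1 * T (2 * k) \<le> d j * T (2 * k)"
    using T_pos[of "2 * k"] k1 dJ[OF j] by (intro mult_right_mono) auto
  moreover have "c j * T (2 * k - 1) > 0"
    using T_pos[of "2 * k - 1"] k1 cJ[OF j] by simp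
  ultimately show ?thesis unfolding A_def using aJ[OF j] by linarith
qed

lemma A_gt_S: "A j > S j (2 * k)"
proof -
  have "1 * S j (2 * k) \<le> a 1 * S j (2 * k)"
    using S_pos[OF j, of "2 * k"] k1 a12 by (intro mult_right_mono) auto
  moreover have "a 2 * S j (2 * k - 1) > 0"
    using S_pos[OF j, of "2 * k - 1"] k1 a12 by simp
  ultimately show ?thesis unfolding A_eq using aJ[OF j] by linarith
qed

lemma A_gt_b: "A j > b"
  using A_gt_T T_gt_b[of "2 * k"] k1 by linarith

end

text \<open>The vertices 1 and 2 swap the roles p and q at every mutation; mutating at q raises x and
  lowers y, mutating at p does the opposite.\<close>
definition fork :: "quiver \<Rightarrow> nat \<Rightarrow> nat \<Rightarrow> nat \<Rightarrow> bool" where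
  "fork X p q x \<longleftrightarrow> skew X \<and> (p = 1 \<and> q = 2 \<or> p = 2 \<and> q = 1) \<and> X p q = b \<and>
     (\<forall>j\<in>J. X j p = S j x \<and> X q j = S j (Suc x) \<and> (\<forall>i\<in>J. X i j = w i j))"

text \<open>The vertex n lies on q -> n -> p like the vertices of J, but its later term is at p
  instead of q; so a mutation that raises x lowers y. As long as the arrows at n have these
  directions, mutations at 1 and 2 do not change h.\<close>

definition spiral :: "quiver \<Rightarrow> nat \<Rightarrow> nat \<Rightarrow> nat \<Rightarrow> nat \<Rightarrow> (nat \<Rightarrow> int) \<Rightarrow> bool" where
  "spiral X p q x y h \<longleftrightarrow> fork X p q x \<and> X n p = T (Suc y) \<and> X q n = T y \<and> (\<forall>j\<in>J. X n j = h j)"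

lemma forkD:
  assumes "fork X p q x"
  shows "skew X" "p = 1 \<and> q = 2 \<or> p = 2 \<and> q = 1" "X p q = b" "X q p = - b"
    and "j \<in> J \<Longrightarrow> X j p = S j x" "j \<in> J \<Longrightarrow> X p j = - S j x"
    and "j \<in> J \<Longrightarrow> X q j = S j (Suc x)" "j \<in> J \<Longrightarrow> X j q = - S j (Suc x)"
    and "i \<in> J \<Longrightarrow> j \<in> J \<Longrightarrow> X i j = w i j"
proof -
  from assms have sk: "skew X" and pq: "X p q = b"
    and J: "\<And>j. j \<in> J \<Longrightarrow> X j p = S j x \<and> X q j = S j (Suc x) \<and> (\<forall>i\<in>J. X i j = w i j)"
    unfolding fork_def by blast+
  show "skew X" "X p q = b" by fact+
  show "p = 1 \<and> q = 2 \<or> p = 2 \<and> q = 1" using assms unfolding fork_def by blast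
  show "X q p = - b" using skewD[OF sk, of q p] pq by simp
  show "X j p = S j x" "X p j = - S j x" "X q j = S j (Suc x)" "X j q = - S j (Suc x)" if "j \<in> J"
    using J[OF that] skewD[OF sk, of p j] skewD[OF sk, of j q] by linarith+
  show "X i j = w i j" if "i \<in> J" "j \<in> J" using J that by blast
qed

lemma spiralD:
  assumes "spiral X p q x y h"
  shows "fork X p q x" "X n p = T (Suc y)" "X p n = - T (Suc y)" "X q n = T y" "X n q = - T y"
    and "j \<in> J \<Longrightarrow> X n j = h j" "j \<in> J \<Longrightarrow> X j n = - h j"
proof -
  from assms have F: "fork X p q x" and X: "X n p = T (Suc y)" "X q n = T y"
    and J: "\<And>j. j \<in> J \<Longrightarrow> X n j = h j"
    unfolding spiral_def by blast+
  note sk = forkD(1)[OF F]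
  show "fork X p q x" "X n p = T (Suc y)" "X q n = T y" by fact+
  show "X p n = - T (Suc y)" "X n q = - T y"
    using X skewD[OF sk, of p n] skewD[OF sk, of n q] by linarith+
  show "X n j = h j" "X j n = - h j" if "j \<in> J"
    using J[OF that] skewD[OF sk, of j n] by linarith+
qed

text \<open>Within {1, 2} and J only p points to q, so apart from signs at q only the entries from p
  to J change, to \<open>b * S j (Suc x) - S j x\<close>. Since \<open>S j x\<close> is not an entry
  at q, it may be negative and x may be 0.\<close>

lemma fork_step_up:
  assumes "fork X p q x"
  shows "fork (mutate q X) q p (Suc x)"
  unfolding fork_def
proof (intro conjI ballI)
  note X = forkD[OF assms]
  show "skew (mutate q X)" by (rule skew_mutate[OF X(1)])
  show "q = 1 \<and> p = 2 \<or> q = 2 \<and> p = 1" using X(2) by blast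
  show "mutate q X q p = b" using X(4) by simp
  fix j assume j: "j \<in> J"
  note jr = J_range[OF j]
  show "mutate q X j q = S j (Suc x)" using X(8)[OF j] by simp
  show "mutate q X p j = S j (Suc (Suc x))"
    using mutate_through[of p q j X] X(2,3) X(6,7)[OF j] S_pos[OF j, of "Suc x"] jr b2
    by (auto simp: S_rec)
  fix i assume i: "i \<in> J"
  show "mutate q X i j = w i j"
    using mutate_out[OF X(1), of i q j] X(2) X(7)[OF i] X(7)[OF j] X(9)[OF i j]
      S_pos[OF i, of "Suc x"] S_pos[OF j, of "Suc x"] jr J_range[OF i] by force
qed

text \<open>The same recurrence read backwards; now the entries at p have to be positive, hence
  \<open>Suc x\<close>.\<close>

lemma fork_step_down:
  assumes "fork X p q (Suc x)"
  shows "fork (mutate p X) q p x"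
  unfolding fork_def
proof (intro conjI ballI)
  note X = forkD[OF assms]
  show "skew (mutate p X)" by (rule skew_mutate[OF X(1)])
  show "q = 1 \<and> p = 2 \<or> q = 2 \<and> p = 1" using X(2) by blast
  show "mutate p X q p = b" using X(4) by simp
  fix j assume j: "j \<in> J"
  note jr = J_range[OF j]
  show "mutate p X j q = S j x"
    using mutate_through[of j p q X] X(2,3) X(5,8)[OF j] S_pos[OF j, of "Suc x"] jr b2
    by (auto simp: S_rec)
  show "mutate p X p j = S j (Suc x)" using X(6)[OF j] by simp
  fix i assume i: "i \<in> J"
  show "mutate p X i j = w i j"
    using mutate_in[OF X(1), of i p j] X(2) X(5)[OF i] X(5)[OF j] X(9)[OF i j]
      S_pos[OF i, of "Suc x"] S_pos[OF j, of "Suc x"] jr J_range[OF i] by force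
qed

lemma spiral_step_up:
  assumes "spiral X p q x (Suc y) h"
  shows "spiral (mutate q X) q p (Suc x) y h"
  unfolding spiral_def
proof (intro conjI ballI)
  note X = spiralD[OF assms] and F = forkD[OF spiralD(1)[OF assms]]
  show "fork (mutate q X) q p (Suc x)" by (rule fork_step_up[OF X(1)])
  show "mutate q X n q = T (Suc y)" using X(5) by simp
  show "mutate q X p n = T y"
    using mutate_through[of p q n X] F(2,3) X(3,4) T_pos[of "Suc y"] n4 b2
    by (auto simp: T_rec)
  fix j assume j: "j \<in> J"
  show "mutate q X n j = h j"
    using mutate_out[OF F(1), of n q j] F(2) F(7)[OF j] X(4) X(6)[OF j] S_pos[OF j, of "Suc x"]
      T_pos[of "Suc y"] n4 J_range[OF j] by force
qed

lemma spiral_step_down: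
  assumes "spiral X p q (Suc x) y h"
  shows "spiral (mutate p X) q p x (Suc y) h"
  unfolding spiral_def
proof (intro conjI ballI)
  note X = spiralD[OF assms] and F = forkD[OF spiralD(1)[OF assms]]
  show "fork (mutate p X) q p x" by (rule fork_step_down[OF X(1)])
  show "mutate p X n q = T (Suc (Suc y))"
    using mutate_through[of n p q X] F(2,3) X(2,5) T_pos[of "Suc y"] n4 b2
    by (auto simp: T_rec)
  show "mutate p X p n = T (Suc y)" using X(3) by simp
  fix j assume j: "j \<in> J"
  show "mutate p X n j = h j"
    using mutate_in[OF F(1), of n p j] F(2) F(5)[OF j] X(2) X(6)[OF j] S_pos[OF j, of "Suc x"]
      T_pos[of "Suc y"] n4 J_range[OF j] by force
qed

text \<open>Started at \<open>Rt\<close>, this describes the subquiver of Q on 1, ..., n-1.\<close>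

lemma fork_sequence:
  assumes "fork X 1 2 0"
  shows "fork (mutate_seq (concat (replicate m [2, 1])) X) 1 2 (2 * m)"
proof (induction m)
  case (Suc m)
  let ?X = "mutate_seq (concat (replicate m [2, 1])) X"
  have "mutate_seq (concat (replicate (Suc m) [2, 1])) X = mutate 1 (mutate 2 ?X)"
    unfolding mutate_seq_def by (subst concat_replicate_Suc) simp
  then show ?case using fork_step_up[OF fork_step_up[OF Suc]] by simp
qed (use assms in \<open>simp add: mutate_seq_def\<close>)

text \<open>With e = 1 the vertex n is a source, with e = -1 it is a sink.\<close>
definition capped :: "quiver \<Rightarrow> int \<Rightarrow> bool" where
  "capped X e \<longleftrightarrow> fork X 1 2 (2 * k) \<and> (\<forall>i\<in>{1..<n}. X n i = e * a i)"

lemma capped_mutate: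
  assumes "capped X (- 1)"
  shows "capped (mutate n X) 1"
proof -
  have F: "fork X 1 2 (2 * k)" and a: "\<And>i. i \<in> {1..<n} \<Longrightarrow> X n i = - a i"
    using assms unfolding capped_def by auto
  note sk = forkD(1)[OF F]
  have eq: "mutate n X i j = X i j" if "i \<in> {1..<n}" "j \<in> {1..<n}" for i j
    using mutate_in[OF sk, of i n j] a[OF that(1)] a[OF that(2)] skewD[OF sk, of i n] skewD[OF sk, of j n]
      a_pos[OF that(1)] a_pos[OF that(2)] that by simp
  have *: "1 \<in> {1..<n}" "2 \<in> {1..<n}" "\<And>j. j \<in> J \<Longrightarrow> j \<in> {1..<n}"
    using n4 by (auto simp: J_def)
  have "fork (mutate n X) 1 2 (2 * k)"
    using F skew_mutate[OF sk, of n] eq[OF *(1,2)] eq[OF *(3) *(1)] eq[OF *(2) *(3)] eq[OF *(3) *(3)]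
    unfolding fork_def by simp
  then show ?thesis using a unfolding capped_def by simp
qed

lemma capped_spiral:
  assumes "capped X 1"
  shows "spiral X 1 2 (2 * k) 0 a"
proof -
  have F: "fork X 1 2 (2 * k)" and a: "\<And>i. i \<in> {1..<n} \<Longrightarrow> X n i = a i"
    using assms unfolding capped_def by auto
  have "X n 1 = a 1" "X n 2 = a 2" "\<And>j. j \<in> J \<Longrightarrow> X n j = a j"
    using a n4 by (auto simp: J_def)
  then show ?thesis
    using F skewD[OF forkD(1)[OF F], of 2 n] unfolding spiral_def by (simp add: T_0 T_1)
qed

text \<open>After r of the mutations at n - 1, n - 2, \<dots>, each of which merely turns a sink into a source.\<close>
definition sgn_at :: "nat \<Rightarrow> nat \<Rightarrow> int" where
  "sgn_at r j = (if j < n - r then 1 else - 1)"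

text \<open>An arrow is reversed once for each mutated end, hence the product of two signs inside J.
  The 3-cycle 1 -> 2 -> n -> 1 persists.\<close>

definition chain :: "quiver \<Rightarrow> nat \<Rightarrow> bool" where
  "chain X r \<longleftrightarrow> skew X \<and> r \<le> n - 3 \<and> X 1 2 = b \<and> X 2 n = T (2 * k) \<and> X n 1 = T (Suc (2 * k)) \<and>
    (\<forall>j\<in>J. X 1 j = sgn_at r j * c j \<and> X 2 j = sgn_at r j * d j \<and> X n j = sgn_at r j * a j \<and>
      (\<forall>i\<in>J. X i j = sgn_at r i * sgn_at r j * w i j))"

lemma spiral_chain:
  assumes "spiral X 1 2 0 (2 * k) a"
  shows "chain X 0"
proof -
  note X = spiralD[OF assms] and F = forkD[OF spiralD(1)[OF assms]]
  show ?thesis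
    unfolding chain_def sgn_at_def
    using X F n4 by (auto simp: S_0 S_1 dest: J_range)
qed

text \<open>The mutated vertex is a sink: 1, 2, n and the smaller vertices of J point to it from the
  start, and the larger ones do so since their own mutations reversed their arrows.\<close>

lemma chain_step:
  assumes X: "chain X r" and r: "Suc r \<le> n - 3"
  shows "chain (mutate (n - 1 - r) X) (Suc r)"
proof -
  define v where "v = n - 1 - r"
  have v: "v \<in> J" "v < n - r" "3 \<le> v" "v < n" using r n4 by (auto simp: v_def J_def)
  have sk: "skew X" using X unfolding chain_def by blast
  have sv: "sgn_at r v = 1" using v unfolding sgn_at_def by simp
  have X1: "X 1 v = c v" "X 2 v = d v" "X n v = a v"
    using X v(1) sv unfolding chain_def by simp_all
  have pos: "X i v \<ge> 0" if "i \<in> V" for i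
  proof -
    from that show ?thesis
    proof (cases rule: V_cases)
      case 4
      have eq: "X i v = sgn_at r i * w i v" using X 4 v sv unfolding chain_def by simp
      consider "i < v" | "i = v" | "v < i" by linarith
      then show ?thesis
      proof cases
        case 1
        then show ?thesis using eq w2[of i v] J_range[OF 4] v by (simp add: sgn_at_def)
      next
        case 2
        then show ?thesis using skew_irrefl[OF sk] by simp
      next
        case 3
        then have "sgn_at r i = - 1" using v_def unfolding sgn_at_def by auto
        then show ?thesis using eq w2[of v i] 3 J_range[OF 4] v skewD[OF skew_w, of i v] by simp
      qed
    qed (use X1 cJ[OF v(1)] dJ[OF v(1)] aJ[OF v(1)] in simp_all)
  qed
  have keep: "mutate v X i j = X i j" if "i \<in> V" "j \<in> V" "i \<noteq> v" "j \<noteq> v" for i j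
    by (rule mutate_in[OF sk that(3,4) pos[OF that(1)] pos[OF that(2)]])
  have s: "sgn_at (Suc r) j = (if j = v then - sgn_at r j else sgn_at r j)" for j
    using r n4 by (auto simp: sgn_at_def v_def)
  note mem = V_mem
  have ne: "1 \<noteq> v" "2 \<noteq> v" "n \<noteq> v" using v by auto
  have 1: "mutate v X i j = sgn_at (Suc r) j * e j" if "X i j = sgn_at r j * e j" "j \<in> J" "i \<in> V" "i \<noteq> v" for i j e
    using that keep[of i j] mem by (cases "j = v") (auto simp: s)
  have 2: "mutate v X i j = sgn_at (Suc r) i * sgn_at (Suc r) j * w i j"
    if ij: "i \<in> J" "j \<in> J" for i j
  proof -
    have eq: "X i j = sgn_at r i * sgn_at r j * w i j" using X ij unfolding chain_def by blast
    have "w i i = 0" by (rule skew_irrefl[OF skew_w])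
    then show ?thesis using eq keep[of i j] mem ij by (cases "i = v"; cases "j = v") (auto simp: s)
  qed
  have "chain (mutate v X) (Suc r)"
    unfolding chain_def
  proof (intro conjI ballI)
    show "mutate v X 1 2 = b" "mutate v X 2 n = T (2 * k)" "mutate v X n 1 = T (Suc (2 * k))"
      using X keep[OF mem(1,2)] keep[OF mem(2,3)] keep[OF mem(3,1)] ne unfolding chain_def by simp_all
    fix j assume j: "j \<in> J"
    show "mutate v X 1 j = sgn_at (Suc r) j * c j" "mutate v X 2 j = sgn_at (Suc r) j * d j"
      "mutate v X n j = sgn_at (Suc r) j * a j"
      using X 1[OF _ j] mem ne j unfolding chain_def by blast+
    show "mutate v X i j = sgn_at (Suc r) i * sgn_at (Suc r) j * w i j" if "i \<in> J" for i
      by (rule 2[OF that j])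
  qed (fact r skew_mutate[OF sk, of v])+
  then show ?thesis unfolding v_def .
qed

text \<open>The state between the last two mutations of the descending block: the entries from J to
  n contain the paths through 2 but not yet those through 1.\<close>

definition turn :: "quiver \<Rightarrow> bool" where
  "turn X \<longleftrightarrow> skew X \<and> X 2 1 = b \<and> X n 2 = T (2 * k) \<and> X 1 n = T (2 * k - 1) \<and>
    (\<forall>j\<in>J. X j 1 = c j \<and> X 2 j = d j \<and> X j n = a j + d j * T (2 * k) \<and> (\<forall>i\<in>J. X i j = w i j))"

lemma chain_turn:
  assumes X: "chain X (n - 3)"
  shows "turn (mutate 2 X)"
proof -
  have sk: "skew X" using X unfolding chain_def by blast
  have s: "sgn_at (n - 3) j = - 1" if "j \<in> J" for j
    using J_range[OF that] n4 by (simp add: sgn_at_def)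
  have X1: "X 1 2 = b" "X 2 n = T (2 * k)" "X n 1 = T (Suc (2 * k))" "X 1 n = - T (Suc (2 * k))"
    using X skewD[OF sk, of 1 n] unfolding chain_def by auto
  have XJ: "X j 1 = c j" "X j 2 = d j" "X 2 j = - d j" "X j n = a j" if "j \<in> J" for j
    using X s[OF that] that skewD[OF sk, of j] unfolding chain_def by simp_all
  have XJJ: "X i j = w i j" if "i \<in> J" "j \<in> J" for i j
    using X s that unfolding chain_def by simp
  \<comment> \<open>The paths 1 -> 2 -> n outnumber the \<open>T (Suc (2 * k))\<close> arrows from n
    to 1; the recurrence gives the surplus.\<close>
  have rec: "T (2 * k - 1) = b * T (2 * k) - T (Suc (2 * k))"
    using T_rec[of "2 * k - 1"] k1 by (simp add: Suc_diff_le)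
  have Tp: "T (2 * k) > 0" using T_pos k1 by simp
  note skm = skew_mutate[OF sk, of 2]
  have "mutate 2 X 2 1 = b" using X1(1) skewD[OF sk, of 2 1] by simp
  moreover have "mutate 2 X n 2 = T (2 * k)" using X1(2) skewD[OF sk, of n 2] by simp
  moreover have "mutate 2 X 1 n = T (2 * k - 1)"
    using mutate_through[of 1 2 n X] X1 Tp b2 n4 rec by simp
  moreover have "mutate 2 X j 1 = c j" "mutate 2 X 2 j = d j"
    "mutate 2 X j n = a j + d j * T (2 * k)" if j: "j \<in> J" for j
    using mutate_in[OF sk, of j 2 1] mutate_through[of j 2 n X] XJ[OF j] X1 Tp b2 n4 dJ[OF j] J_range[OF j]
    by simp_all
  moreover have "mutate 2 X i j = w i j" if ij: "i \<in> J" "j \<in> J" for i j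
    using mutate_in[OF sk, of i 2 j] XJ XJJ dJ J_range ij by force
  ultimately show ?thesis using skm unfolding turn_def by blast
qed

lemma turnD:
  assumes "turn X"
  shows "skew X" "X 2 1 = b" "X 1 2 = - b" "X n 2 = T (2 * k)" "X 2 n = - T (2 * k)" "X 1 n = T (2 * k - 1)"
    and "j \<in> J \<Longrightarrow> X j 1 = c j" "j \<in> J \<Longrightarrow> X 2 j = d j" "j \<in> J \<Longrightarrow> X j n = a j + d j * T (2 * k)"
    and "i \<in> J \<Longrightarrow> j \<in> J \<Longrightarrow> X i j = w i j"
proof -
  from assms have sk: "skew X" and X: "X 2 1 = b" "X n 2 = T (2 * k)"
    unfolding turn_def by blast+
  show "skew X" "X 2 1 = b" "X n 2 = T (2 * k)" by fact+
  show "X 1 2 = - b" "X 2 n = - T (2 * k)"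
    using X skewD[OF sk, of 1 2] skewD[OF sk, of 2 n] by linarith+
  show "X 1 n = T (2 * k - 1)"
    "j \<in> J \<Longrightarrow> X j 1 = c j" "j \<in> J \<Longrightarrow> X 2 j = d j" "j \<in> J \<Longrightarrow> X j n = a j + d j * T (2 * k)"
    "i \<in> J \<Longrightarrow> j \<in> J \<Longrightarrow> X i j = w i j"
    using assms unfolding turn_def by blast+
qed

text \<open>The paths j -> 1 -> n complete \<open>A j\<close>, and the paths 2 -> 1 -> n turn
  \<open>- T (2 * k)\<close> into \<open>T (2 * k - 2)\<close>. For k = 1 the index y is thereby 0
  at once.\<close>

lemma turn_spiral:
  assumes "turn X"
  shows "spiral (mutate 1 X) 1 2 0 (2 * k - 2) (\<lambda>j. - A j)"
proof -
  note X = turnD[OF assms]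
  note sk = X(1)
  have Tp: "T (2 * k - 1) > 0" using T_pos k1 by simp
  obtain m where m: "2 * k = Suc (Suc m)" using k1 by (cases k) auto
  have "fork (mutate 1 X) 1 2 0"
    unfolding fork_def
  proof (intro conjI ballI)
    show "skew (mutate 1 X)" by (rule skew_mutate[OF sk])
    show "mutate 1 X 1 2 = b" using X by simp
    fix j assume j: "j \<in> J"
    note jr = J_range[OF j]
    show "mutate 1 X j 1 = S j 0" using X(7)[OF j] by (simp add: S_0)
    show "mutate 1 X 2 j = S j (Suc 0)"
      using mutate_in[OF sk, of 2 1 j] X(2) X(7,8)[OF j] cJ[OF j] b2 jr by (simp add: S_1)
    fix i assume i: "i \<in> J"
    show "mutate 1 X i j = w i j"
      using mutate_in[OF sk, of i 1 j] X(7)[OF i] X(7)[OF j] X(10)[OF i j] cJ[OF i] cJ[OF j] jr J_range[OF i] by force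
  qed simp
  moreover have "mutate 1 X n 1 = T (Suc (2 * k - 2))"
    using X(6) skewD[OF sk, of n 1] m by simp
  moreover have "mutate 1 X 2 n = T (2 * k - 2)"
    using mutate_through[of 2 1 n X] X Tp b2 n4 unfolding m by (simp add: T_rec)
  moreover have "mutate 1 X n j = - A j" if j: "j \<in> J" for j
    using mutate_through[of j 1 n X] X(6) X(7,9)[OF j] Tp cJ[OF j] J_range[OF j] n4
      skewD[OF skew_mutate[OF sk], of 1 n j] by (simp add: A_def algebra_simps)
  ultimately show ?thesis unfolding spiral_def by blast
qed

text \<open>At y = 0 the negative \<open>T 0\<close> makes n point to 2, so the last mutation at 2
  is not a case of \<open>spiral_step_up\<close>: paths n -> 2 -> j now cancel arrows from j to
  n.\<close>

definition closing :: "quiver \<Rightarrow> bool" where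
  "closing X \<longleftrightarrow> skew X \<and> X 2 1 = b \<and> X 2 n = a 2 \<and> X n 1 = a 1 \<and>
    (\<forall>j\<in>J. X 1 j = S j (2 * k) \<and> X j 2 = S j (2 * k - 1) \<and> X j n = a j + a 1 * S j (2 * k) \<and>
      (\<forall>i\<in>J. X i j = w i j))"

lemma spiral_closing:
  assumes "spiral X 1 2 (2 * k - 2) 0 (\<lambda>j. - A j)"
  shows "closing (mutate 2 X)"
proof -
  note X = spiralD[OF assms] and F = forkD[OF spiralD(1)[OF assms]]
  obtain m where m: "2 * k = Suc (Suc m)" using k1 by (cases k) auto
  have "fork (mutate 2 X) 2 1 (Suc (2 * k - 2))" by (rule fork_step_up[OF X(1)])
  from forkD[OF this] have F': "skew (mutate 2 X)" "mutate 2 X 2 1 = b"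
    "\<And>j. j \<in> J \<Longrightarrow> mutate 2 X j 2 = S j (2 * k - 1)"
    "\<And>j. j \<in> J \<Longrightarrow> mutate 2 X 1 j = S j (2 * k)"
    "\<And>i j. i \<in> J \<Longrightarrow> j \<in> J \<Longrightarrow> mutate 2 X i j = w i j"
    unfolding m by simp_all
  moreover have "mutate 2 X 2 n = a 2" using X(4) by (simp add: T_0)
  moreover have "mutate 2 X n 1 = a 1"
    using mutate_in[OF F(1), of n 2 1] F(3) X(2,5) a12 b2 n4 by (simp add: T_0 T_1)
  \<comment> \<open>The number of paths n -> 2 -> j is exactly the summand of \<open>A_eq\<close>
    with the factor \<open>a 2\<close>.\<close>
  moreover have "mutate 2 X j n = a j + a 1 * S j (2 * k)" if j: "j \<in> J" for j
    using mutate_through[of n 2 j X] X(5) X(6)[OF j] F(7)[OF j] S_pos[OF j, of "2 * k - 1"] a12 k1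
      skewD[OF F'(1), of j n] n4 J_range[OF j] unfolding A_eq m by (simp add: T_0)
  ultimately show ?thesis unfolding closing_def by blast
qed

section \<open>Locating the explicit quivers in the sequence\<close>

context
  fixes Q assumes Q: "capped Q (- 1)"
begin

text \<open>t counts the mutations at 1 and 2, and the additional one is that at n. Each of the t
  exchanges p and q, hence the parity.\<close>

lemma quiver_at_first:
  assumes "t \<le> 2 * k"
  shows "spiral (quiver_at n k Q (Suc t)) (if even t then 1 else 2) (if even t then 2 else 1) (2 * k - t) t a"
  using assms
proof (induction t)
  case 0
  have "quiver_at n k Q (Suc 0) = mutate n Q"
    using quiver_at_Suc[of 0 n k Q] n4 by (simp add: quiver_at_0 vertex_seq_nth(1))
  then show ?case using capped_spiral[OF capped_mutate[OF Q]] by simp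
next
  case (Suc t)
  let ?p = "if even t then 1 else 2 :: nat" and ?q = "if even t then 2 else 1 :: nat"
  have "2 * k - t = Suc (2 * k - Suc t)" using Suc.prems by simp
  then have "spiral (quiver_at n k Q (Suc t)) ?p ?q (Suc (2 * k - Suc t)) t a"
    using Suc by (simp only: Suc_leD)
  from spiral_step_down[OF this]
  have "spiral (mutate ?p (quiver_at n k Q (Suc t))) ?q ?p (2 * k - Suc t) (Suc t) a" .
  moreover have "quiver_at n k Q (Suc (Suc t)) = mutate ?p (quiver_at n k Q (Suc t))"
    using quiver_at_Suc[of "Suc t" n k Q] Suc.prems n4 vertex_seq_nth(2)[of t k n] by simp
  moreover have "(if even (Suc t) then 1 else 2) = ?q" "(if even (Suc t) then 2 else 1) = ?p" by auto
  ultimately show ?case by (simp only:)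
qed

lemma quiver_at_chain:
  assumes "r \<le> n - 3"
  shows "chain (quiver_at n k Q (2 * k + 1 + r)) r"
  using assms
proof (induction r)
  case 0
  show ?case using spiral_chain quiver_at_first[of "2 * k"] by simp
next
  case (Suc r)
  have "quiver_at n k Q (Suc (2 * k + 1 + r)) = mutate (n - 1 - r) (quiver_at n k Q (2 * k + 1 + r))"
    using quiver_at_Suc[of "2 * k + 1 + r" n k Q] vertex_seq_nth(3)[of r n k] Suc.prems n4 by simp
  then show ?case using chain_step[of _ r] Suc by simp
qed

lemma quiver_at_turn: "turn (quiver_at n k Q (2 * k + n - 1))"
proof -
  have "quiver_at n k Q (Suc (2 * k + 1 + (n - 3))) = mutate 2 (quiver_at n k Q (2 * k + 1 + (n - 3)))"
    using quiver_at_Suc[of "2 * k + 1 + (n - 3)" n k Q] vertex_seq_nth(3)[of "n - 3" n k] n4 by simp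
  then have "turn (quiver_at n k Q (Suc (2 * k + 1 + (n - 3))))"
    using chain_turn[OF quiver_at_chain[of "n - 3"]] by (simp only: order_refl)
  moreover have "Suc (2 * k + 1 + (n - 3)) = 2 * k + n - 1" using n4 by simp
  ultimately show ?thesis by (simp only:)
qed

lemma quiver_at_second:
  assumes "x \<le> 2 * k - 2"
  shows "spiral (quiver_at n k Q (2 * k + n + x)) (if even x then 1 else 2) (if even x then 2 else 1)
    x (2 * k - 2 - x) (\<lambda>j. - A j)"
  using assms
proof (induction x)
  case 0
  have e: "2 * k + 1 + (n - 2) = 2 * k + n - 1" "Suc (2 * k + n - 1) = 2 * k + n" using n4 by simp_all
  have "vertex_seq n k ! (2 * k + n - 1) = 1"
    using vertex_seq_nth(3)[of "n - 2" n k] n4 unfolding e by simp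
  then have "quiver_at n k Q (2 * k + n) = mutate 1 (quiver_at n k Q (2 * k + n - 1))"
    using quiver_at_Suc[of "2 * k + n - 1" n k Q] n4 k1 unfolding e by simp
  then show ?case using turn_spiral[OF quiver_at_turn] by simp
next
  case (Suc x)
  let ?p = "if even x then 1 else 2 :: nat" and ?q = "if even x then 2 else 1 :: nat"
  have "2 * k - 2 - x = Suc (2 * k - 2 - Suc x)" using Suc.prems by simp
  then have "spiral (quiver_at n k Q (2 * k + n + x)) ?p ?q x (Suc (2 * k - 2 - Suc x)) (\<lambda>j. - A j)"
    using Suc by (simp only: Suc_leD)
  from spiral_step_up[OF this]
  have "spiral (mutate ?q (quiver_at n k Q (2 * k + n + x))) ?q ?p (Suc x) (2 * k - 2 - Suc x) (\<lambda>j. - A j)" .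
  moreover have "quiver_at n k Q (2 * k + n + Suc x) = mutate ?q (quiver_at n k Q (2 * k + n + x))"
    using quiver_at_Suc[of "2 * k + n + x" n k Q] vertex_seq_nth(4)[of x k n] Suc.prems n4 by simp
  moreover have "(if even (Suc x) then 1 else 2) = ?q" "(if even (Suc x) then 2 else 1) = ?p" by auto
  ultimately show ?case by (simp only:)
qed

lemma quiver_at_closing: "closing (quiver_at n k Q (4 * k + n - 1))"
proof -
  have e: "2 * k + n + (2 * k - 2) = 4 * k + n - 2" "Suc (4 * k + n - 2) = 4 * k + n - 1"
    using k1 n4 by simp_all
  have "spiral (quiver_at n k Q (4 * k + n - 2)) 1 2 (2 * k - 2) 0 (\<lambda>j. - A j)"
    using quiver_at_second[of "2 * k - 2"] unfolding e by simp
  moreover have "quiver_at n k Q (4 * k + n - 1) = mutate 2 (quiver_at n k Q (4 * k + n - 2))"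
    using quiver_at_Suc[of "4 * k + n - 2" n k Q] vertex_seq_nth(4)[of "2 * k - 2" k n] n4 k1
    unfolding e by simp
  ultimately show ?thesis using spiral_closing by simp
qed

end

end

section \<open>Telling the quivers apart\<close>

text \<open>The condition for n = 4 in terms of the parameters: \<open>a 1\<close> is
  \<open>Q 1 4\<close>, and \<open>d 3\<close> is \<open>Rt 2 3\<close>, which equals
  \<open>R 2 3\<close>.\<close>

locale generic_cycle_data = cycle_data +
  assumes exceptional: "n = 4 \<Longrightarrow> a 1 \<noteq> d 3"
begin

text \<open>By \<open>lrec_match\<close> the coincidence would descend to the initial terms
  \<open>a 1\<close> and \<open>d 3\<close>.\<close>

lemma TS_match:
  assumes "n = 4" "T i = S 3 j" "T (Suc i) = S 3 (Suc j)"
  shows False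
  using lrec_match[of b "- a 2" "a 1" "- c 3" "d 3" i j] assms exceptional b2 a12 cJ[OF three_J] dJ[OF three_J]
  unfolding S_def T_def by simp


section \<open>Invariants and shapes of the quivers without source or sink\<close>

definition weighted_hub :: "quiver \<Rightarrow> int \<Rightarrow> bool" where
  "weighted_hub X z \<longleftrightarrow> skew X \<and> (\<exists>p q. hub V X p q \<and> X p q = z)"

text \<open>By \<open>tri_wide_unique\<close> there is then no other decomposition, in particular
  none with the singleton class of a hub.\<close>

definition wide :: "quiver \<Rightarrow> bool" where
  "wide X \<longleftrightarrow> skew X \<and> (\<exists>v A B. tri V X v A B \<and> card A \<ge> 2 \<and> card B \<ge> 2)"

lemma similar_weighted_hub:
  assumes "similar V X Y" "weighted_hub X z" "weighted_hub Y z'"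
  shows "z = z'"
  using assms similar_hub_weight[OF assms(1)] n4 unfolding weighted_hub_def by fastforce

lemma weighted_hub_not_wide:
  assumes "similar V X Y" "weighted_hub X z" "wide Y"
  shows False
  using assms hub_not_wide_tri[OF assms(1)] n4 unfolding weighted_hub_def wide_def by fastforce

text \<open>Increasing sequences cannot agree crosswise. A reversal exchanges the ends of the hub
  and would require this of every vertex that it keeps in J.\<close>

lemma S_swap:
  assumes "i \<in> J" "j \<in> J" "S i x = S j (Suc y)" "S i (Suc x) = S j y"
  shows False
  using S_mono[OF assms(1), of x "Suc x"] S_mono[OF assms(2), of y "Suc y"] assms(3,4) by simp

text \<open>Positive indices make all terms of S and T that occur positive, so every other vertex
  lies on q -> z -> p. The boundary cases x = 0 and y = 0 have other shapes.\<close>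

lemma spiral_hub:
  assumes "spiral X p q x y h" "x \<ge> 1" "y \<ge> 1"
  shows "hub V X p q"
  unfolding hub_def
proof (intro conjI ballI)
  note X = spiralD[OF assms(1)] and F = forkD[OF spiralD(1)[OF assms(1)]]
  show "p \<in> V" "q \<in> V" "p \<noteq> q" using F(2) V_mem by auto
  show "X p q > 0" using F(3) b2 by simp
  fix z assume z: "z \<in> V - {p,q}"
  then have "z = n \<or> z \<in> J" using F(2) V_cases[of z] by auto
  then show "X q z > 0" "X z p > 0"
    using X(2,4) T_pos[of y] T_pos[of "Suc y"] F(5,7)[of z] S_pos[of z x] S_pos[of z "Suc x"] assms(2,3)
    by auto
qed

lemma turn_hub:
  assumes "turn X"
  shows "hub V X n 2"
  unfolding hub_def
proof (intro conjI ballI)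
  note X = turnD[OF assms]
  have T: "T (2 * k) > 0" "T (2 * k - 1) > 0" using T_pos k1 by simp_all
  show "n \<in> V" "2 \<in> V" "n \<noteq> 2" using n4 by auto
  show "X n 2 > 0" using X(4) T by simp
  fix z assume z: "z \<in> V - {n,2}"
  then have "z = 1 \<or> z \<in> J" using V_cases[of z] by auto
  moreover have "a z + d z * T (2 * k) > 0" if "z \<in> J"
    using T dJ[OF that] aJ[OF that] by (intro add_pos_pos) simp_all
  ultimately have "X 2 z > 0 \<and> X z n > 0"
    using X(2,6) X(8,9)[of z] T b2 dJ[of z] by (elim disjE) simp_all
  then show "X 2 z > 0" "X z n > 0" by blast+
qed

text \<open>At x = 0 the negative \<open>S j 0\<close> makes 1 point to J, and the hub is n -> 1
  instead of 1 -> 2.\<close>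

lemma lead_hub:
  assumes "spiral X 1 2 0 y (\<lambda>j. - A j)" "y \<ge> 1"
  shows "hub V X n 1"
  unfolding hub_def
proof (intro conjI ballI)
  note X = spiralD[OF assms(1)] and F = forkD[OF spiralD(1)[OF assms(1)]]
  show "n \<in> V" "1 \<in> V" "n \<noteq> 1" using n4 by auto
  show "X n 1 > 0" using X(2) T_pos by simp
  fix z assume z: "z \<in> V - {n,1}"
  then have "z = 2 \<or> z \<in> J" using V_cases[of z] by auto
  then show "X 1 z > 0" "X z n > 0"
    using X(4) X(7)[of z] F(3) F(6)[of z] T_pos[of y] assms(2) b2 cJ[of z] A_gt_b[of z]
    by (auto simp: S_0)
qed

text \<open>At y = 0 it is the arrow between 2 and n that is turned around; k > 1 keeps x
  positive.\<close>

lemma late_tri: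
  assumes "spiral X 1 2 (2 * k - 2) 0 (\<lambda>j. - A j)" "k > 1"
  shows "tri V X 2 J {n,1}"
proof -
  note X = spiralD[OF assms(1)] and F = forkD[OF spiralD(1)[OF assms(1)]]
  have "X 2 j > 0" "X j n > 0" "X j 1 > 0" if j: "j \<in> J" for j
    using F(5,7)[OF j] X(7)[OF j] A_gt_b[OF j] b2 S_pos[OF j] assms(2) by simp_all
  moreover have "X n 2 > 0" "X 1 2 > 0" using X(5) F(3) b2 a12 by (simp_all add: T_0)
  moreover have "V = insert 2 (J \<union> {n,1})" using V_eq by auto
  ultimately show ?thesis unfolding tri_def using three_J by blast
qed

lemma short_tri:
  assumes "spiral X 1 2 0 0 (\<lambda>j. - A j)"
  shows "tri V X n {1,2} J"
proof -
  note X = spiralD[OF assms(1)] and F = forkD[OF spiralD(1)[OF assms(1)]]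
  have "X j n > 0" "X 1 j > 0" "X 2 j > 0" if j: "j \<in> J" for j
    using F(6,7)[OF j] X(7)[OF j] A_gt_b[OF j] b2 cJ[OF j] dJ[OF j] by (simp_all add: S_0 S_1)
  moreover have "X n 1 > 0" "X n 2 > 0" using X(2,5) a12 by (simp_all add: T_0 T_1)
  moreover have "V = insert n ({1,2} \<union> J)" using V_eq by auto
  ultimately show ?thesis unfolding tri_def using three_J by blast
qed

lemma closingD:
  assumes "closing X"
  shows "skew X" "X 2 1 = b" "X 2 n = a 2" "X n 1 = a 1"
    and "j \<in> J \<Longrightarrow> X 1 j = S j (2 * k)" "j \<in> J \<Longrightarrow> X j 2 = S j (2 * k - 1)"
    and "j \<in> J \<Longrightarrow> X j n = a j + a 1 * S j (2 * k)" "j \<in> J \<Longrightarrow> X j n > 0"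
proof -
  show "skew X" "X 2 1 = b" "X 2 n = a 2" "X n 1 = a 1"
    "j \<in> J \<Longrightarrow> X 1 j = S j (2 * k)" "j \<in> J \<Longrightarrow> X j 2 = S j (2 * k - 1)"
    and n: "j \<in> J \<Longrightarrow> X j n = a j + a 1 * S j (2 * k)"
    using assms unfolding closing_def by blast+
  show "X j n > 0" if "j \<in> J"
  proof -
    have "a 1 * S j (2 * k) > 0" using S_pos[OF that, of "2 * k"] a12 k1 by simp
    then show ?thesis using n[OF that] aJ[OF that] by linarith
  qed
qed

lemma closing_tri:
  assumes "closing X"
  shows "tri V X 1 J {2,n}"
proof -
  note X = closingD[OF assms]
  have "X 1 j > 0" "X j 2 > 0" "X j n > 0" if j: "j \<in> J" for j
    using X(5,6,8)[OF j] S_pos[OF j] k1 by simp_all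
  moreover have "X 2 1 > 0" "X n 1 > 0" using X(2,4) b2 a12 by simp_all
  moreover have "V = insert 1 (J \<union> {2,n})" using V_eq by auto
  moreover have "J \<noteq> {}" using three_J by blast
  ultimately show ?thesis unfolding tri_def by simp
qed

text \<open>The position in the sequence is determined by y, so p, q and x can stay
  existential.\<close>

definition rim_a :: "quiver \<Rightarrow> nat \<Rightarrow> bool" where
  "rim_a X y \<longleftrightarrow> (\<exists>p q x. x \<ge> 1 \<and> y \<ge> 1 \<and> spiral X p q x y a)"

definition rim_A :: "quiver \<Rightarrow> nat \<Rightarrow> bool" where
  "rim_A X y \<longleftrightarrow> (\<exists>p q x. x \<ge> 1 \<and> y \<ge> 1 \<and> spiral X p q x y (\<lambda>j. - A j))"

text \<open>The first spiral of the second half; \<open>late\<close> is the last one. For k = 1 they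
  coincide and have yet another shape, \<open>short\<close>, hence the condition on k.\<close>

definition lead :: "quiver \<Rightarrow> bool" where
  "lead X \<longleftrightarrow> k > 1 \<and> spiral X 1 2 0 (2 * k - 2) (\<lambda>j. - A j)"

definition late :: "quiver \<Rightarrow> bool" where
  "late X \<longleftrightarrow> k > 1 \<and> spiral X 1 2 (2 * k - 2) 0 (\<lambda>j. - A j)"

definition short :: "quiver \<Rightarrow> bool" where
  "short X \<longleftrightarrow> k = 1 \<and> spiral X 1 2 0 0 (\<lambda>j. - A j)"

lemma rim_weighted_hub:
  assumes "rim_a X y \<or> rim_A X y"
  shows "weighted_hub X b"
proof -
  obtain p q x h where X: "x \<ge> 1" "y \<ge> 1" "spiral X p q x y h"
    using assms unfolding rim_a_def rim_A_def by blast
  show ?thesis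
    unfolding weighted_hub_def using spiral_hub[OF X(3,1,2)] forkD(1,3)[OF spiralD(1)[OF X(3)]] by blast
qed

lemma turn_weighted_hub: "turn X \<Longrightarrow> weighted_hub X (T (2 * k))"
  unfolding weighted_hub_def using turn_hub turnD(1,4) by blast

lemma lead_weighted_hub:
  assumes "lead X"
  shows "weighted_hub X (T (2 * k - 1))"
proof -
  have X: "spiral X 1 2 0 (2 * k - 2) (\<lambda>j. - A j)" and k: "k > 1" using assms unfolding lead_def by auto
  have "Suc (2 * k - 2) = 2 * k - 1" using k by simp
  then have "X n 1 = T (2 * k - 1)" using spiralD(2)[OF X] by simp
  then show ?thesis
    unfolding weighted_hub_def using lead_hub[OF X] forkD(1)[OF spiralD(1)[OF X]] k
    by (intro conjI exI) simp_all
qed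

text \<open>J has n - 3 elements, so n = 5 is where it stops being a singleton.\<close>

lemma wide_five:
  assumes "n \<ge> 5" "late X \<or> short X \<or> closing X"
  shows "wide X"
proof -
  have c: "card J \<ge> 2" "card {n,1} \<ge> 2" "card {1,2::nat} \<ge> 2" "card {2,n} \<ge> 2"
    using assms(1) card_J by auto
  from assms(2) show ?thesis
  proof (elim disjE)
    assume "late X"
    then have X: "spiral X 1 2 (2 * k - 2) 0 (\<lambda>j. - A j)" "k > 1" unfolding late_def by auto
    show ?thesis unfolding wide_def using late_tri[OF X] forkD(1)[OF spiralD(1)[OF X(1)]] c by blast
  next
    assume "short X"
    then have X: "spiral X 1 2 0 0 (\<lambda>j. - A j)" unfolding short_def by auto
    show ?thesis unfolding wide_def using short_tri[OF X] forkD(1)[OF spiralD(1)[OF X]] c by blast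
  next
    assume X: "closing X"
    show ?thesis unfolding wide_def using closing_tri[OF X] closingD(1)[OF X] c by blast
  qed
qed

section \<open>The same decompositions as hubs when n = 4\<close>

lemma tri_hub_out: "tri V X v {q} B \<Longrightarrow> skew X \<Longrightarrow> hub V X v q"
  using skew_irrefl[of X v] unfolding tri_def hub_def by (auto; force)

lemma tri_hub_in: "tri V X v M {p} \<Longrightarrow> skew X \<Longrightarrow> hub V X p v"
  using skew_irrefl[of X v] unfolding tri_def hub_def by (auto; force)

lemma late_hub_four:
  assumes "n = 4" "late X"
  shows "hub V X 2 3" "X 2 3 = S 3 (2 * k - 1)" "weighted_hub X (S 3 (2 * k - 1))"
proof -
  have X: "spiral X 1 2 (2 * k - 2) 0 (\<lambda>j. - A j)" "k > 1" using assms(2) unfolding late_def by auto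
  note F = forkD[OF spiralD(1)[OF X(1)]]
  show h: "hub V X 2 3" using tri_hub_out late_tri[OF X] F(1) J_four[OF assms(1)] by simp
  have "Suc (2 * k - 2) = 2 * k - 1" using X(2) by simp
  then show w: "X 2 3 = S 3 (2 * k - 1)" using F(7)[OF three_J] by simp
  show "weighted_hub X (S 3 (2 * k - 1))" unfolding weighted_hub_def using h w F(1) by blast
qed

lemma short_hub_four:
  assumes "n = 4" "short X"
  shows "weighted_hub X (A 3)"
proof -
  have X: "spiral X 1 2 0 0 (\<lambda>j. - A j)" using assms(2) unfolding short_def by auto
  note sk = forkD(1)[OF spiralD(1)[OF X(1)]]
  have "hub V X 3 n" using tri_hub_in short_tri[OF X] sk J_four[OF assms(1)] by simp
  moreover have "X 3 n = A 3" using spiralD(7)[OF X three_J] by simp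
  ultimately show ?thesis unfolding weighted_hub_def using sk by blast
qed

lemma closing_hub_four:
  assumes "n = 4" "closing X"
  shows "hub V X 1 3" "weighted_hub X (S 3 (2 * k))"
proof -
  note X = closingD[OF assms(2)]
  show h: "hub V X 1 3" using tri_hub_out closing_tri[OF assms(2)] X(1) J_four[OF assms(1)] by simp
  show "weighted_hub X (S 3 (2 * k))" unfolding weighted_hub_def using h X(5)[OF three_J] X(1) by blast
qed

text \<open>The hub of a rim quiver weighs exactly b. The other quiver has a wide decomposition or,
  for n = 4, a hub heavier than b.\<close>

lemma rim_not_late:
  assumes "similar V X Y" "rim_a X y \<or> rim_A X y" "late Y \<or> short Y \<or> closing Y"
  shows False
proof (cases "n = 4")
  case False
  then show False using weighted_hub_not_wide rim_weighted_hub wide_five assms n4 by fastforce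
next
  case True
  have "\<exists>z>b. weighted_hub Y z"
    using assms(3)
  proof (elim disjE)
    assume "late Y"
    moreover from this have "k > 1" unfolding late_def by blast
    ultimately show ?thesis using late_hub_four(3)[OF True] S_gt_b[OF three_J, of "2 * k - 1"] by fastforce
  next
    assume "short Y"
    then show ?thesis using short_hub_four[OF True] A_gt_b[OF three_J] by blast
  next
    assume "closing Y"
    then show ?thesis using closing_hub_four(2)[OF True] S_gt_b[OF three_J, of "2 * k"] k1 by fastforce
  qed
  then show False using similar_weighted_hub[OF assms(1) rim_weighted_hub[OF assms(2)]] by blast
qed

lemma rim_not_turn:
  assumes "similar V X Y" "rim_a X y \<or> rim_A X y" "turn Y \<or> lead Y"
  shows False
proof -
  have "\<exists>z>b. weighted_hub Y z"
    using assms(3)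
  proof
    assume "turn Y"
    then show ?thesis using turn_weighted_hub T_gt_b[of "2 * k"] k1 by fastforce
  next
    assume "lead Y"
    moreover from this have "k > 1" unfolding lead_def by blast
    ultimately show ?thesis using lead_weighted_hub T_gt_b[of "2 * k - 1"] by fastforce
  qed
  then show False using similar_weighted_hub[OF assms(1) rim_weighted_hub[OF assms(2)]] by blast
qed

lemma turn_not_lead:
  assumes "similar V X Y" "turn X" "lead Y"
  shows False
  using similar_weighted_hub[OF assms(1) turn_weighted_hub[OF assms(2)] lead_weighted_hub[OF assms(3)]]
    T_eq k1 by simp

lemma turn_not_short:
  assumes "similar V X Y" "turn X" "short Y"
  shows False
proof (cases "n = 4")
  case True
  show False
    using similar_weighted_hub[OF assms(1) turn_weighted_hub[OF assms(2)] short_hub_four[OF True assms(3)]]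
      A_gt_T[OF three_J] by simp
next
  case False
  then show False
    using weighted_hub_not_wide[OF assms(1) turn_weighted_hub[OF assms(2)]] wide_five assms(3) n4 by simp
qed

section \<open>Four vertices: comparing single weights\<close>

context
  fixes X Y
  assumes sim: "similar V X Y" and four: "n = 4"
begin

text \<open>The order expected by \<open>similar_hub_four\<close>: tail and head of the hub, then
  the other two vertices along their arrow. The four listings belong to \<open>turn\<close>,
  \<open>closing\<close>, \<open>late\<close> and \<open>lead\<close>.\<close>

lemma V_four: "V = {n,2,3,1}" "V = {1,3,2,n}" "V = {2,3,n,1}" "V = {n,1,2,3}"
  unfolding V_eq J_four[OF four] by blast+

lemma card_V_four: "card V = 4"
  unfolding four by simp

lemma turn_not_closing_four:
  assumes X: "turn X" and Y: "closing Y"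
  shows False
proof -
  note XD = turnD[OF X] and YD = closingD[OF Y]
  have "X 3 1 > 0" "Y 2 n > 0" using XD(7)[OF three_J] cJ[OF three_J] YD(3) a12 by simp_all
  from similar_hub_four[OF sim XD(1) YD(1) card_V_four turn_hub[OF X] V_four(1) this(1)
      closing_hub_four(1)[OF four Y] V_four(2) this(2)]
  \<comment> \<open>An isomorphism forces the first equation and a reversal the second, which is
    \<open>a 1 = d 3\<close>.\<close>
  have "Y 2 1 = X 3 n \<or> Y n 1 = X 2 3" by blast
  moreover have "Y n 1 \<noteq> X 2 3"
    using YD(4) XD(8)[OF three_J] exceptional[OF four] by simp
  moreover have "X 3 n > b"
  proof -
    have "1 * T (2 * k) \<le> d 3 * T (2 * k)"
      using T_pos[of "2 * k"] k1 dJ[OF three_J] by (intro mult_right_mono) auto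
    then show ?thesis using XD(9)[OF three_J] aJ[OF three_J] T_gt_b[of "2 * k"] k1 by simp
  qed
  ultimately show False using YD(2) by simp
qed

lemma turn_not_late_four:
  assumes X: "turn X" and Y: "late Y"
  shows False
proof -
  have sp: "spiral Y 1 2 (2 * k - 2) 0 (\<lambda>j. - A j)" and k: "k > 1" using Y unfolding late_def by auto
  note XD = turnD[OF X] and YD = spiralD[OF sp] and YF = forkD[OF spiralD(1)[OF sp]]
  have "X 3 1 > 0" "Y n 1 > 0" using XD(7)[OF three_J] cJ[OF three_J] YD(2) a12 by (simp_all add: T_1)
  from similar_hub_four[OF sim XD(1) YF(1) card_V_four turn_hub[OF X] V_four(1) this(1)
      late_hub_four(1)[OF four Y] V_four(3) this(2)]
  \<comment> \<open>Both left-hand sides, \<open>a 2\<close> and \<open>S 3 (2 * k - 2)\<close>, lie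
    below the common hub weight \<open>T (2 * k)\<close>, and \<open>X 3 n\<close> lies above
    it.\<close>
  have "Y n 2 = X 3 n \<or> Y 3 1 = X 3 n" by blast
  moreover have "T (2 * k) = S 3 (2 * k - 1)"
    using similar_weighted_hub[OF sim turn_weighted_hub[OF X] late_hub_four(3)[OF four Y]] .
  moreover have "S 3 (2 * k - 2) < S 3 (2 * k - 1)" using S_mono[OF three_J] k by simp
  moreover have "X 3 n > T (2 * k)"
  proof -
    have "1 * T (2 * k) \<le> d 3 * T (2 * k)"
      using T_pos[of "2 * k"] k1 dJ[OF three_J] by (intro mult_right_mono) auto
    then show ?thesis using XD(9)[OF three_J] aJ[OF three_J] by simp
  qed
  moreover have "T (2 * k) > a 2" using T_gt_a2 k by simp
  ultimately show False using YD(5) YF(5)[OF three_J] by (simp add: T_0)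
qed

lemma lead_not_late_four:
  assumes X: "lead X" and Y: "late Y"
  shows False
proof -
  have sp: "spiral X 1 2 0 (2 * k - 2) (\<lambda>j. - A j)" and sp': "spiral Y 1 2 (2 * k - 2) 0 (\<lambda>j. - A j)"
    and k: "k > 1" using X Y unfolding lead_def late_def by auto
  note XD = spiralD[OF sp] and XF = forkD[OF spiralD(1)[OF sp]]
  note YD = spiralD[OF sp'] and YF = forkD[OF spiralD(1)[OF sp']]
  have X23: "X 2 3 = d 3" using XF(7)[OF three_J] by (simp add: S_1)
  have Yn1: "Y n 1 = a 1" using YD(2) by (simp add: T_1)
  have "X 2 3 > 0" "Y n 1 > 0" using X23 Yn1 dJ[OF three_J] a12 by simp_all
  from similar_hub_four[OF sim XF(1) YF(1) card_V_four lead_hub[OF sp] V_four(4) this(1)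
      late_hub_four(1)[OF four Y] V_four(3) this(2)] k
  \<comment> \<open>The arrow outside the hub keeps its weight in either alternative.\<close>
  have "Y n 1 = X 2 3" by simp
  then show False using X23 Yn1 exceptional[OF four] by simp
qed

lemma lead_not_closing_four:
  assumes X: "lead X" and Y: "closing Y"
  shows False
proof -
  have sp: "spiral X 1 2 0 (2 * k - 2) (\<lambda>j. - A j)" and k: "k > 1" using X unfolding lead_def by auto
  note XD = spiralD[OF sp] and XF = forkD[OF spiralD(1)[OF sp]] and YD = closingD[OF Y]
  have "X 2 3 > 0" "Y 2 n > 0" using XF(7)[OF three_J] dJ[OF three_J] YD(3) a12 by (simp_all add: S_1)
  from similar_hub_four[OF sim XF(1) YD(1) card_V_four lead_hub[OF sp] V_four(4) this(1)
      closing_hub_four(1)[OF four Y] V_four(2) this(2)] k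
  \<comment> \<open>An isomorphism would equate b with \<open>T (2 * k - 2)\<close>, whose index is
    at least 2 as k > 1; a reversal would equate \<open>S 3 (2 * k - 1)\<close> with
    \<open>A 3\<close>.\<close>
  have "Y 2 1 = X 2 n \<or> Y 3 2 = X 3 n" by auto
  moreover have "X 2 n > b" using XD(4) T_gt_b[of "2 * k - 2"] k by simp
  moreover have "S 3 (2 * k - 1) < S 3 (2 * k)" using S_mono[OF three_J] k by simp
  ultimately show False using YD(2,6) XD(7) three_J A_gt_S[OF three_J] by simp
qed

end

lemma turn_not_closing:
  assumes "similar V X Y" "turn X \<or> lead X" "late Y \<or> closing Y"
  shows False
proof (cases "n = 4")
  case True
  then show False
    using turn_not_closing_four turn_not_late_four lead_not_late_four lead_not_closing_four assms by blast
next
  case False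
  then show False
    using weighted_hub_not_wide[OF assms(1)] turn_weighted_hub lead_weighted_hub wide_five assms n4 by fastforce
qed

section \<open>Rim quivers among themselves\<close>

text \<open>The entries from n to J have one sign, so an isomorphism cannot move n into J and a
  vertex of J to n; hence n is fixed and the terms of T agree. A reversal sends all of J to n by
  \<open>S_swap\<close>, so n = 4, the vertices 3 and n are exchanged, and \<open>TS_match\<close>
  applies.\<close>

lemma rim_same_index:
  assumes sim: "similar V X Y"
    and X: "spiral X p q x y h" "x \<ge> 1" "y \<ge> 1" and Y: "spiral Y p' q' x' y' h" "x' \<ge> 1" "y' \<ge> 1"
    and h: "(\<forall>j\<in>J. h j > 0) \<or> (\<forall>j\<in>J. h j < 0)"
  shows "y = y'"
proof -
  note XD = spiralD[OF X(1)] and XF = forkD[OF spiralD(1)[OF X(1)]]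
  note YD = spiralD[OF Y(1)] and YF = forkD[OF spiralD(1)[OF Y(1)]]
  have hubs: "hub V X p q" "hub V Y p' q'" using spiral_hub X Y by blast+
  have card: "card V \<ge> 4" using n4 by simp
  have hne: "h i \<noteq> - h j" if "i \<in> J" "j \<in> J" for i j
  proof -
    have "h i > 0 \<and> h j > 0 \<or> h i < 0 \<and> h j < 0" using h that by blast
    then show ?thesis by linarith
  qed
  have mem: "p \<in> V" "q \<in> V" "n \<in> V" "\<And>j. j \<in> J \<Longrightarrow> j \<in> V" using XF(2) V_mem by auto
  have J': "j \<in> J \<or> j = n" if "j \<in> V" "j \<noteq> p'" "j \<noteq> q'" for j
    using that YF(2) V_cases[of j] by auto
  from sim show ?thesis
  proof (cases rule: similarE)
    case (1 \<pi>)
    note eq = iso_by_eq[OF 1] and inj = iso_by_inj[OF 1] and map = iso_by_mem[OF 1]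
    have pq: "\<pi> p = p'" "\<pi> q = q'" using iso_by_hub_eq[OF 1 YF(1) card hubs] by blast+
    have "n \<noteq> p" "n \<noteq> q" using XF(2) n4 by auto
    then have "\<pi> n \<in> J \<or> \<pi> n = n" using J'[OF map[OF mem(3)]] inj[of n p] inj[of n q] pq by simp
    moreover have "\<pi> n \<notin> J"
    proof
      assume j: "\<pi> n \<in> J"
      obtain i where i: "i \<in> V" "\<pi> i = n" using iso_by_surj[OF 1 mem(3)] .
      have "\<pi> p \<noteq> n" "\<pi> q \<noteq> n" "\<pi> n \<noteq> n" using pq YF(2) n4 J_range[OF j] by auto
      then have "i \<noteq> p" "i \<noteq> q" "i \<noteq> n" using i(2) by blast+
      then have iJ: "i \<in> J" using XF(2) V_cases[OF i(1)] by metis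
      have "Y (\<pi> n) n = h i" using eq[OF mem(3) i(1)] i(2) XD(6)[OF iJ] by simp
      then show False using YD(7)[OF j] hne[OF iJ j] by simp
    qed
    ultimately have "\<pi> n = n" by blast
    then have "T (Suc y) = T (Suc y')" using eq[OF mem(3,1)] pq XD(2) YD(2) by simp
    then show ?thesis using T_eq by simp
  next
    case (2 \<pi>)
    have eq: "Y (\<pi> i) (\<pi> j) = X j i" if "i \<in> V" "j \<in> V" for i j using iso_by_eq[OF 2 that] by simp
    note inj = iso_by_inj[OF 2] and map = iso_by_mem[OF 2]
    have pq: "\<pi> p = q'" "\<pi> q = p'" using iso_by_hub_eq[OF 2 YF(1) card hub_opp[OF hubs(1)] hubs(2)] by blast+
    have out: "\<pi> j \<in> J \<or> \<pi> j = n" if "j = n \<or> j \<in> J" for j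
    proof -
      have "j \<in> V" using that mem by blast
      moreover have "j \<ge> 3" using that n4 J_range[of j] by auto
      then have "j \<noteq> p" "j \<noteq> q" using XF(2) by auto
      ultimately show ?thesis using J'[OF map] inj[of j p] inj[of j q] pq by simp
    qed
    have no: "\<pi> j = n" if j: "j \<in> J" for j
    proof (rule ccontr)
      assume "\<pi> j \<noteq> n"
      then have i: "\<pi> j \<in> J" using out j by blast
      have "S j x = S (\<pi> j) (Suc x')"
        using eq[OF mem(1) mem(4)[OF j]] pq XF(5)[OF j] YF(7)[OF i] by simp
      moreover have "S j (Suc x) = S (\<pi> j) x'"
        using eq[OF mem(4)[OF j] mem(2)] pq XF(7)[OF j] YF(5)[OF i] by simp
      ultimately show False using S_swap[OF j i] by blast
    qed
    have n: "n = 4"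
    proof (rule ccontr)
      assume "n \<noteq> 4"
      then have "4 \<in> J" using n4 by (simp add: J_def)
      then show False using no[of 4] no[OF three_J] inj[of 4 3] by simp
    qed
    have "\<pi> n \<noteq> n" using no[OF three_J] inj[of n 3] n by auto
    then have "\<pi> n = 3" using out J_four[OF n] by blast
    then have "T y = S 3 x'" "T (Suc y) = S 3 (Suc x')"
      using eq[OF mem(3,2)] eq[OF mem(1,3)] pq XD(2,4) YF(5,7)[OF three_J] by simp_all
    then show ?thesis using TS_match[OF n] by blast
  qed
qed

lemma rim_a_index:
  assumes "similar V X Y" "rim_a X y" "rim_a Y y'"
  shows "y = y'"
proof -
  have "\<forall>j\<in>J. a j > 0" using aJ by fastforce
  then show ?thesis using rim_same_index[OF assms(1)] assms(2,3) unfolding rim_a_def by metis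
qed

lemma rim_A_index:
  assumes "similar V X Y" "rim_A X y" "rim_A Y y'"
  shows "y = y'"
proof -
  have "\<forall>j\<in>J. - A j < 0" using A_gt_b b2 by fastforce
  then show ?thesis using rim_same_index[OF assms(1)] assms(2,3) unfolding rim_A_def by metis
qed

text \<open>The total weight outside the hub is the same for similar rim quivers, and in it the two
  kinds differ only through h.\<close>

lemma rim_total:
  assumes "spiral X p q x y h"
  shows "(\<Sum>i\<in>insert n J. \<Sum>j\<in>insert n J. \<bar>X i j\<bar>) = 2 * (\<Sum>j\<in>J. \<bar>h j\<bar>) + (\<Sum>i\<in>J. \<Sum>j\<in>J. \<bar>w i j\<bar>)"
proof -
  note XD = spiralD[OF assms] and XF = forkD[OF spiralD(1)[OF assms]]
  have n: "n \<notin> J" by (simp add: J_def)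
  have row: "(\<Sum>j\<in>insert n J. \<bar>X i j\<bar>) = \<bar>X i n\<bar> + (\<Sum>j\<in>J. \<bar>X i j\<bar>)" for i
    using n finite_J by simp
  have "(\<Sum>j\<in>J. \<bar>X n j\<bar>) = (\<Sum>j\<in>J. \<bar>h j\<bar>)" "(\<Sum>i\<in>J. \<bar>X i n\<bar>) = (\<Sum>j\<in>J. \<bar>h j\<bar>)"
    "(\<Sum>i\<in>J. \<Sum>j\<in>J. \<bar>X i j\<bar>) = (\<Sum>i\<in>J. \<Sum>j\<in>J. \<bar>w i j\<bar>)"
    using XD(6,7) XF(9) by (auto intro!: sum.cong)
  then show ?thesis
    using n finite_J skew_irrefl[OF XF(1)] unfolding row by (simp add: sum.distrib)
qed

lemma rim_a_not_rim_A:
  assumes sim: "similar V X Y" and "rim_a X y" "rim_A Y y'"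
  shows False
proof -
  obtain p q x where X: "x \<ge> 1" "y \<ge> 1" "spiral X p q x y a" using assms(2) unfolding rim_a_def by blast
  obtain p' q' x' where Y: "x' \<ge> 1" "y' \<ge> 1" "spiral Y p' q' x' y' (\<lambda>j. - A j)"
    using assms(3) unfolding rim_A_def by blast
  note XF = forkD[OF spiralD(1)[OF X(3)]] and YF = forkD[OF spiralD(1)[OF Y(3)]]
  have hubs: "hub V X p q" "hub V Y p' q'" using spiral_hub X Y by blast+
  have card: "card V \<ge> 4" using n4 by simp
  have rest: "V - {p, q} = insert n J" "V - {p', q'} = insert n J"
    using XF(2) YF(2) n4 unfolding J_def by auto
  \<comment> \<open>Absolute values treat isomorphism and reversal at once, and a sum over
    everything outside the hub does not depend on where n goes.\<close>
  have "\<exists>\<pi>. \<pi> permutes V \<and> \<pi> ` {p,q} = {p',q'} \<and> (\<forall>i\<in>V. \<forall>j\<in>V. \<bar>Y (\<pi> i) (\<pi> j)\<bar> = \<bar>X i j\<bar>)"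
    using sim
  proof (cases rule: similarE)
    case (1 \<pi>)
    then show ?thesis
      using iso_by_permutes[OF 1] iso_by_hub_eq[OF 1 YF(1) card hubs] iso_by_eq[OF 1]
      by (intro exI[of _ \<pi>]) auto
  next
    case (2 \<pi>)
    have "\<bar>X j i\<bar> = \<bar>X i j\<bar>" for i j using skewD[OF XF(1), of i j] by simp
    then show ?thesis
      using iso_by_permutes[OF 2] iso_by_hub_eq[OF 2 YF(1) card hub_opp[OF hubs(1)] hubs(2)] iso_by_eq[OF 2]
      by (intro exI[of _ \<pi>]) auto
  qed
  then obtain \<pi> where \<pi>: "\<pi> permutes V" "\<pi> ` {p,q} = {p',q'}"
    "\<And>i j. i \<in> V \<Longrightarrow> j \<in> V \<Longrightarrow> \<bar>Y (\<pi> i) (\<pi> j)\<bar> = \<bar>X i j\<bar>" by blast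
  have inj: "inj \<pi>" by (rule permutes_inj[OF \<pi>(1)])
  have im: "insert n J = \<pi> ` insert n J"
    using image_set_diff[OF inj, of V "{p,q}"] permutes_image[OF \<pi>(1)] \<pi>(2) rest by simp
  have sub: "insert n J \<subseteq> V" using V_eq by blast
  have "(\<Sum>i\<in>insert n J. \<Sum>j\<in>insert n J. \<bar>Y i j\<bar>)
      = (\<Sum>i\<in>\<pi> ` insert n J. \<Sum>j\<in>\<pi> ` insert n J. \<bar>Y i j\<bar>)"
    by (simp only: im[symmetric])
  also have "\<dots> = (\<Sum>i\<in>insert n J. \<Sum>j\<in>insert n J. \<bar>Y (\<pi> i) (\<pi> j)\<bar>)"
    by (simp only: sum.reindex[OF inj_on_subset[OF inj subset_UNIV]] comp_def)
  also have "\<dots> = (\<Sum>i\<in>insert n J. \<Sum>j\<in>insert n J. \<bar>X i j\<bar>)"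
    using \<pi>(3) sub by (intro sum.cong refl) blast
  finally have "(\<Sum>j\<in>J. \<bar>a j\<bar>) = (\<Sum>j\<in>J. \<bar>A j\<bar>)"
    unfolding rim_total[OF X(3)] rim_total[OF Y(3)] by simp
  moreover have "(\<Sum>j\<in>J. \<bar>a j\<bar>) < (\<Sum>j\<in>J. \<bar>A j\<bar>)"
  proof (rule sum_strict_mono[OF finite_J])
    show "\<bar>a j\<bar> < \<bar>A j\<bar>" if "j \<in> J" for j using A_gt_a[OF that] aJ[OF that] by simp
  qed (use three_J in blast)
  ultimately show False by simp
qed

text \<open>For n >= 5 the unique decomposition forces 2 to go to 1. An isomorphism maps J onto J
  but may permute it, hence the comparison of sums. A reversal sends some j in J to 2 and would give
  \<open>S j (2 * k - 1) = b\<close>.\<close>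

lemma late_not_closing:
  assumes sim: "similar V X Y" and X: "late X" and Y: "closing Y"
  shows False
proof (cases "n = 4")
  case True
  show False
    using similar_weighted_hub[OF sim late_hub_four(3)[OF True X] closing_hub_four(2)[OF True Y]]
      S_eq[OF three_J] k1 by simp
next
  case False
  then have c: "card J \<ge> 2" "card {2,n} \<ge> 2" using n4 card_J by auto
  have sp: "spiral X 1 2 (2 * k - 2) 0 (\<lambda>j. - A j)" and k: "k > 1" using X unfolding late_def by auto
  note XF = forkD[OF spiralD(1)[OF sp]] and YD = closingD[OF Y]
  have e: "Suc (2 * k - 2) = 2 * k - 1" using k by simp
  note u = tri_wide_unique[OF YD(1) closing_tri[OF Y] _ c]
  from sim show False
  proof (cases rule: similarE)
    case (1 \<pi>)
    note u1 = u[OF iso_by_tri[OF 1 late_tri[OF sp k]]]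
    have "S j (2 * k - 1) = S (\<pi> j) (2 * k)" if j: "j \<in> J" for j
    proof -
      have "\<pi> j \<in> J" using u1(2) j by blast
      then show ?thesis
        using iso_by_eq[OF 1 V_mem(2) V_mem(4)[OF j]] u1(1) YD(5) XF(7)[OF j] e by simp
    qed
    then have "(\<Sum>j\<in>J. S j (2 * k - 1)) = (\<Sum>j\<in>J. S (\<pi> j) (2 * k))" by simp
    also have "\<dots> = (\<Sum>j\<in>\<pi> ` J. S j (2 * k))"
      by (subst sum.reindex[OF permutes_inj_on[OF iso_by_permutes[OF 1]]]) simp
    finally have "(\<Sum>j\<in>J. S j (2 * k - 1)) = (\<Sum>j\<in>J. S j (2 * k))" using u1(2) by simp
    moreover have "(\<Sum>j\<in>J. S j (2 * k - 1)) < (\<Sum>j\<in>J. S j (2 * k))"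
      using three_J k by (intro sum_strict_mono finite_J) (auto simp: S_mono)
    ultimately show False by simp
  next
    case (2 \<pi>)
    note u2 = u[OF iso_by_tri[OF 2 tri_opp[OF late_tri[OF sp k]]]]
    have "2 \<in> \<pi> ` J" using u2(3) by simp
    then obtain j where j: "j \<in> J" "\<pi> j = 2" by force
    have "b = S j (2 * k - 1)"
      using iso_by_eq[OF 2 V_mem(4)[OF j(1)] V_mem(2)] u2(1) j(2) YD(2) XF(7)[OF j(1)] e by simp
    moreover have "2 \<le> 2 * k - 1" using k by simp
    ultimately show False using S_gt_b[OF j(1), of "2 * k - 1"] by simp
  qed
qed

text \<open>As in \<open>late_not_closing\<close>, with isomorphism and reversal exchanged because J
  is now the class pointing to the centre.\<close>

lemma short_not_closing:
  assumes sim: "similar V X Y" and X: "short X" and Y: "closing Y"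
  shows False
proof (cases "n = 4")
  case True
  show False
    using similar_weighted_hub[OF sim short_hub_four[OF True X] closing_hub_four(2)[OF True Y]]
      A_gt_S[OF three_J] by simp
next
  case False
  then have c: "card J \<ge> 2" "card {2,n} \<ge> 2" using n4 card_J by auto
  have sp: "spiral X 1 2 0 0 (\<lambda>j. - A j)" using X unfolding short_def by auto
  note XD = spiralD[OF sp] and YD = closingD[OF Y]
  note u = tri_wide_unique[OF YD(1) closing_tri[OF Y] _ c]
  from sim show False
  proof (cases rule: similarE)
    case (1 \<pi>)
    note u1 = u[OF iso_by_tri[OF 1 short_tri[OF sp]]]
    have "2 \<in> \<pi> ` J" using u1(3) by simp
    then obtain j where j: "j \<in> J" "\<pi> j = 2" by force
    have "b = A j"
      using iso_by_eq[OF 1 V_mem(4)[OF j(1)] V_mem(3)] u1(1) j(2) YD(2) XD(7)[OF j(1)] by simp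
    then show False using A_gt_b[OF j(1)] by simp
  next
    case (2 \<pi>)
    note u2 = u[OF iso_by_tri[OF 2 tri_opp[OF short_tri[OF sp]]]]
    have "A j = S (\<pi> j) (2 * k)" if j: "j \<in> J" for j
    proof -
      have "\<pi> j \<in> J" using u2(2) j by blast
      then show ?thesis
        using iso_by_eq[OF 2 V_mem(3) V_mem(4)[OF j]] u2(1) YD(5) XD(7)[OF j] by simp
    qed
    then have "(\<Sum>j\<in>J. A j) = (\<Sum>j\<in>J. S (\<pi> j) (2 * k))" by simp
    also have "\<dots> = (\<Sum>j\<in>\<pi> ` J. S j (2 * k))"
      by (subst sum.reindex[OF permutes_inj_on[OF iso_by_permutes[OF 2]]]) simp
    finally have "(\<Sum>j\<in>J. A j) = (\<Sum>j\<in>J. S j (2 * k))" using u2(2) by simp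
    moreover have "(\<Sum>j\<in>J. S j (2 * k)) < (\<Sum>j\<in>J. A j)"
      using three_J A_gt_S by (intro sum_strict_mono finite_J) auto
    ultimately show False by simp
  qed
qed

section \<open>Quivers in the middle of the sequence\<close>

text \<open>A height with 1, 2, n at level 0, the vertices of J still to be mutated above in
  increasing order, and the mutated ones below. All arrows outside the 3-cycle on 1, 2, n go
  upwards.\<close>

definition lev :: "nat \<Rightarrow> nat \<Rightarrow> int" where
  "lev r j = (if j \<in> J then if j < n - r then int j else int j - int n else 0)"

lemma chain_lev:
  assumes X: "chain X r" and "i \<in> V" "j \<in> V" "X i j > 0"
  shows "lev r i < lev r j \<or> i \<in> {1,2,n} \<and> j \<in> {1,2,n}"
proof -
  have sk: "skew X" using X unfolding chain_def by blast
  have J0: "lev r j = 0" if "j \<in> {1,2,n}" for j using that by (auto simp: lev_def J_def)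
  have to: "sgn_at r j > 0 \<longleftrightarrow> lev r j > 0" "sgn_at r j < 0 \<longleftrightarrow> lev r j < 0" if "j \<in> J" for j
    using that J_range[OF that] by (auto simp: sgn_at_def lev_def)
  have row: "X i j > 0 \<longleftrightarrow> lev r j > 0" "X j i > 0 \<longleftrightarrow> lev r j < 0" if j: "j \<in> J" and i: "i \<in> {1,2,n}" for i j
  proof -
    have "\<exists>e>0. X i j = sgn_at r j * e"
      using X i j cJ[OF j] dJ[OF j] aJ[OF j] unfolding chain_def
      by (elim insertE) (auto intro: exI[of _ "c j"] exI[of _ "d j"] exI[of _ "a j"])
    then obtain e where e: "e > 0" "X i j = sgn_at r j * e" by blast
    then show "X i j > 0 \<longleftrightarrow> lev r j > 0" "X j i > 0 \<longleftrightarrow> lev r j < 0"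
      using to[OF j] skewD[OF sk, of j i] by (simp_all add: zero_less_mult_iff mult_less_0_iff)
  qed
  show ?thesis
  proof (cases "i \<in> J"; cases "j \<in> J")
    assume ij: "i \<in> J" "j \<in> J"
    have "X i j = sgn_at r i * sgn_at r j * w i j" using X ij unfolding chain_def by blast
    moreover have "w i j > 0 \<longleftrightarrow> i < j" "w i j < 0 \<longleftrightarrow> j < i"
      using w2[of i j] w2[of j i] J_range[OF ij(1)] J_range[OF ij(2)] skewD[OF skew_w, of i j]
        skew_irrefl[OF skew_w, of i] by (cases i j rule: linorder_cases; simp)+
    ultimately show ?thesis
      using assms(4) J_range[OF ij(1)] J_range[OF ij(2)] ij
      by (auto simp: sgn_at_def lev_def split: if_splits)
  next
    assume ij: "i \<in> J" "j \<notin> J"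
    then have j: "j \<in> {1,2,n}" using assms(3) V_cases[of j] by auto
    show ?thesis using row(2)[OF ij(1) j] J0[OF j] assms(4) by simp
  next
    assume ij: "i \<notin> J" "j \<in> J"
    then have i: "i \<in> {1,2,n}" using assms(2) V_cases[of i] by auto
    show ?thesis using row(1)[OF ij(2) i] J0[OF i] assms(4) by simp
  next
    assume ij: "i \<notin> J" "j \<notin> J"
    then show ?thesis using assms(2,3) V_cases[of i] V_cases[of j] by auto
  qed
qed

text \<open>While some vertex of J is still to be mutated, the highest vertex is a sink; afterwards
  3 is the lowest and a source.\<close>

lemma chain_not_inner:
  assumes X: "chain X r"
  shows "\<exists>v\<in>V. \<not> inner_vertex V X v"
proof (cases "r < n - 3")
  case True
  define v where "v = n - 1 - r"
  have v: "v \<in> J" "v \<in> V" "lev r v = int v" "v \<notin> {1,2,n}" using True n4 by (auto simp: v_def J_def lev_def)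
  have "lev r x \<le> lev r v" for x
    using v(1) J_range[of x] unfolding v(3) by (auto simp: lev_def v_def)
  then have "\<not> X v x > 0" if "x \<in> V" for x
    using chain_lev[OF X v(2) that] v(4) by (metis leD)
  then show ?thesis using v(2) unfolding inner_vertex_def by blast
next
  case False
  then have r: "r = n - 3" using X unfolding chain_def by simp
  have v: "3 \<in> V" "lev r 3 = 3 - int n" "3 \<notin> {1,2,n}" using n4 three_J r by (auto simp: lev_def)
  have "lev r 3 \<le> lev r x" for x
    using n4 J_range[of x] unfolding v(2) by (auto simp: lev_def)
  then have "\<not> X x 3 > 0" if "x \<in> V" for x
    using chain_lev[OF X that v(1)] v(3) by (metis leD)
  then show ?thesis using v(1) unfolding inner_vertex_def by blast
qed

text \<open>A cycle cannot go upwards all the way round, so it lies in 1, 2, n; of the three arrows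
  there only 1 -> 2 has weight b, the others being terms of T.\<close>

lemma chain_cycle:
  assumes X: "chain X r" and mem: "x \<in> V" "y \<in> V" "z \<in> V"
    and pos: "X x y > 0" "X y z > 0" "X z x > 0" and b: "X x y = b"
  shows "x = 1 \<and> y = 2 \<and> z = n"
proof -
  have sk: "skew X" using X unfolding chain_def by blast
  have tri: "x \<in> {1,2,n}" "y \<in> {1,2,n}" "z \<in> {1,2,n}"
  proof -
    have J0: "lev r j = 0" if "j \<in> {1,2,n}" for j using that by (auto simp: lev_def J_def)
    show "x \<in> {1,2,n}" "y \<in> {1,2,n}" "z \<in> {1,2,n}"
      using chain_lev[OF X mem(1,2) pos(1)] chain_lev[OF X mem(2,3) pos(2)]
        chain_lev[OF X mem(3,1) pos(3)] J0[of x] J0[of y] J0[of z] by fastforce+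
  qed
  have e: "X 1 2 = b" "X 2 n = T (2 * k)" "X n 1 = T (Suc (2 * k))"
    "X 2 1 < 0" "X n 2 < 0" "X 1 n < 0" "X 1 1 = 0" "X 2 2 = 0" "X n n = 0"
    using X b2 T_pos[of "2 * k"] T_pos[of "Suc (2 * k)"] k1
      skewD[OF sk, of 2 1] skewD[OF sk, of n 2] skewD[OF sk, of 1 n] skew_irrefl[OF sk]
    unfolding chain_def by auto
  have "T (2 * k) > b" "T (Suc (2 * k)) > b" using T_gt_b k1 by simp_all
  then show ?thesis using tri pos b e by (elim insertE emptyE) simp_all
qed

text \<open>An isomorphism fixes 1 by \<open>chain_cycle\<close>, and the in-neighbours of 1 are n
  and the r mutated vertices. A reversal would equate \<open>T (2 * k)\<close> with
  \<open>T (Suc (2 * k))\<close>.\<close>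

lemma chain_index:
  assumes sim: "similar V X Y" and X: "chain X r" and Y: "chain Y r'"
  shows "r = r'"
proof -
  have XD: "skew X" "X 1 2 = b" "X 2 n = T (2 * k)" "X n 1 = T (Suc (2 * k))" using X unfolding chain_def by auto
  have YD: "Y 2 n = T (2 * k)" using Y unfolding chain_def by auto
  have p: "b > 0" "T (2 * k) > 0" "T (Suc (2 * k)) > 0" using b2 T_pos k1 by simp_all
  note mem = V_mem(1-3)
  from sim show ?thesis
  proof (cases rule: similarE)
    case (1 \<pi>)
    note eq = iso_by_eq[OF 1] and map = iso_by_mem[OF 1]
    have one: "\<pi> 1 = 1"
      using chain_cycle[OF Y map[OF mem(1)] map[OF mem(2)] map[OF mem(3)]]
        eq[OF mem(1,2)] eq[OF mem(2,3)] eq[OF mem(3,1)] XD p by simp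
    have indeg: "card {i\<in>V. Z i 1 > 0} = Suc s" if Z: "chain Z s" for Z s
    proof -
      have sk: "skew Z" using Z unfolding chain_def by blast
      have s: "s \<le> n - 3" using Z unfolding chain_def by blast
      have "{i\<in>V. Z i 1 > 0} = {n - s..n}"
      proof -
        have J: "Z i 1 > 0 \<longleftrightarrow> n - s \<le> i" if i: "i \<in> J" for i
        proof -
          have "Z 1 i = sgn_at s i * c i" using Z i unfolding chain_def by blast
          then show ?thesis using skewD[OF sk, of i 1] cJ[OF i] by (auto simp: sgn_at_def)
        qed
        have "Z n 1 > 0" "\<not> Z 2 1 > 0" "\<not> Z 1 1 > 0"
          using Z p skewD[OF sk, of 2 1] skew_irrefl[OF sk, of 1] unfolding chain_def by simp_all
        moreover have "\<not> n - s \<le> 1" "\<not> n - s \<le> 2" "n - s \<le> n" using s n4 by simp_all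
        ultimately have "Z i 1 > 0 \<longleftrightarrow> n - s \<le> i" if "i = 1 \<or> i = 2 \<or> i = n \<or> i \<in> J" for i
          using that J[of i] by blast
        then have "Z i 1 > 0 \<longleftrightarrow> n - s \<le> i" if "i \<in> V" for i
          using V_cases[OF that] by metis
        then show ?thesis using s n4 by auto
      qed
      then show ?thesis using s n4 by simp
    qed
    have "{i\<in>V. Y i 1 > 0} = \<pi> ` {i\<in>V. X i 1 > 0}"
    proof
      show "{i\<in>V. Y i 1 > 0} \<subseteq> \<pi> ` {i\<in>V. X i 1 > 0}"
      proof
        fix i assume i: "i \<in> {i\<in>V. Y i 1 > 0}"
        then obtain i' where i': "i' \<in> V" "\<pi> i' = i" using iso_by_surj[OF 1, of i] by auto
        then show "i \<in> \<pi> ` {i\<in>V. X i 1 > 0}" using i eq[OF i'(1) mem(1)] one by auto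
      qed
      show "\<pi> ` {i\<in>V. X i 1 > 0} \<subseteq> {i\<in>V. Y i 1 > 0}"
        using eq[OF _ mem(1)] one map by auto
    qed
    then show ?thesis using indeg[OF X] indeg[OF Y] iso_by_card[OF 1] by simp
  next
    case (2 \<pi>)
    have eq: "Y (\<pi> i) (\<pi> j) = X j i" if "i \<in> V" "j \<in> V" for i j using iso_by_eq[OF 2 that] by simp
    note map = iso_by_mem[OF 2]
    have "\<pi> 2 = 1 \<and> \<pi> 1 = 2 \<and> \<pi> n = n"
      using chain_cycle[OF Y map[OF mem(2)] map[OF mem(1)] map[OF mem(3)]]
        eq[OF mem(2,1)] eq[OF mem(1,3)] eq[OF mem(3,2)] XD p by simp
    then have "T (2 * k) = T (Suc (2 * k))" using eq[OF mem(1,3)] XD YD by simp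
    then show ?thesis using T_eq by simp
  qed
qed

section \<open>The first two quivers\<close>

lemma cappedD:
  assumes "capped X e"
  shows "fork X 1 2 (2 * k)" "i \<in> {1..<n} \<Longrightarrow> X n i = e * a i"
  using assms unfolding capped_def by simp_all

lemma capped_not_inner:
  assumes "capped X e" "e = 1 \<or> e = - 1"
  shows "\<not> inner_vertex V X n"
proof -
  note F = forkD[OF cappedD(1)[OF assms(1)]]
  have "X n i = 0" if "i \<in> V" "i \<notin> {1..<n}" for i
    using that skew_irrefl[OF F(1), of n] by auto
  moreover have "X i n = - X n i" for i by (rule skewD[OF F(1)])
  ultimately show ?thesis
    using cappedD(2)[OF assms(1)] a_pos assms(2) unfolding inner_vertex_def
    by (smt (verit) mult_cancel_right1 mult_minus_left)
qed

lemma fork_hub: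
  assumes "fork X 1 2 x" "x \<ge> 1"
  shows "hub {1..<n} X 1 2"
  unfolding hub_def
proof (intro conjI ballI)
  note F = forkD[OF assms(1)]
  show "1 \<in> {1..<n}" "2 \<in> {1..<n}" "1 \<noteq> (2::nat)" "X 1 2 > 0" using n4 F(3) b2 by auto
  fix z assume "z \<in> {1..<n} - {1,2}"
  then have z: "z \<in> J" by (auto simp: J_def)
  show "X 2 z > 0" "X z 1 > 0" using F(5,7)[OF z] S_pos[OF z] assms(2) by simp_all
qed

lemma capped_inner:
  assumes "capped X e" "v \<in> {1..<n}"
  shows "inner_vertex V X v"
proof -
  note F = forkD[OF cappedD(1)[OF assms(1)]]
  have "X 1 2 > 0" using F(3) b2 by simp
  moreover have "X 2 j > 0" "X j 1 > 0" if "j \<in> J" for j using F(5,7)[OF that] S_pos[OF that] k1 by simp_all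
  moreover have "v = 1 \<or> v = 2 \<or> v \<in> J" using assms(2) by (auto simp: J_def)
  ultimately show ?thesis using V_mem three_J unfolding inner_vertex_def by metis
qed

text \<open>Only n is not inner, so it is fixed, and only a reversal can turn the sink into a
  source. It would reverse the subquiver on 1, ..., n-1. For n >= 5 that has a hub and
  \<open>S_swap\<close> applies; for n = 4 it is a 3-cycle with three different weights, whose
  cyclic order a reversal changes.\<close>

lemma capped_distinct:
  assumes sim: "similar V X Y" and X: "capped X (- 1)" and Y: "capped Y 1"
  shows False
proof -
  note XF = forkD[OF cappedD(1)[OF X]] and YF = forkD[OF cappedD(1)[OF Y]]
  note mem = V_mem
  have xn: "\<not> inner_vertex V X n" by (rule capped_not_inner[OF X]) simp
  have stay: "\<pi> n = n" if iso: "iso_by V \<pi> Z Y" "\<not> inner_vertex V Z n" for \<pi> Z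
  proof (rule ccontr)
    assume "\<pi> n \<noteq> n"
    then have "\<pi> n \<in> {1..<n}" using iso_by_mem[OF iso(1) mem(3)] by auto
    then show False using capped_inner[OF Y] iso_by_inner_vertex[OF iso(1) mem(3)] iso(2) by blast
  qed
  from sim show False
  proof (cases rule: similarE)
    case (1 \<pi>)
    have n: "\<pi> n = n" by (rule stay[OF 1 xn])
    have "\<pi> 1 \<in> V" "\<pi> 1 \<noteq> n" using iso_by_mem[OF 1 mem(1)] iso_by_inj[OF 1, of 1 n] n n4 by auto
    then have "\<pi> 1 \<in> {1..<n}" by auto
    then have "Y n (\<pi> 1) > 0" using cappedD(2)[OF Y] a_pos by simp
    moreover have "X n 1 < 0" using cappedD(2)[OF X, of 1] a12 n4 by simp
    ultimately show False using iso_by_eq[OF 1 mem(3,1)] n by simp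
  next
    case (2 \<pi>)
    have n: "\<pi> n = n" using stay[OF 2] xn by simp
    have eq: "Y (\<pi> i) (\<pi> j) = X j i" if "i \<in> V" "j \<in> V" for i j using iso_by_eq[OF 2 that] by simp
    have iso: "iso_by {1..<n} \<pi> (opp X) Y"
    proof -
      have "\<pi> permutes {1..<n}"
        by (rule permutes_superset[OF iso_by_permutes[OF 2]]) (use n in auto)
      then show ?thesis using eq unfolding iso_by_def by simp
    qed
    have map: "\<pi> j \<in> {1..<n}" if "j \<in> {1..<n}" for j by (rule iso_by_mem[OF iso that])
    note inj = iso_by_inj[OF 2]
    note m12 = mem(1,2) and m3 = mem(4)[OF three_J]
    have e: "Y (\<pi> 2) (\<pi> 1) = b" "Y (\<pi> 3) (\<pi> 2) = S 3 (Suc (2 * k))" "Y (\<pi> 1) (\<pi> 3) = S 3 (2 * k)"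
      using eq[OF m12(2,1)] eq[OF m3 m12(2)] eq[OF m12(1) m3] XF(3) XF(5,7)[OF three_J] by simp_all
    show False
    proof (cases "n = 4")
      case False
      then have card: "card {1..<n} \<ge> 4" using n4 by simp
      note h = fork_hub[OF cappedD(1)[OF X]] fork_hub[OF cappedD(1)[OF Y]]
      have p: "\<pi> 2 = 1" "\<pi> 1 = 2"
        using iso_by_hub_eq[OF iso YF(1) card hub_opp[OF h(1)] h(2)] k1 by simp_all
      have "\<pi> 3 \<in> {1..<n}" "\<pi> 3 \<noteq> 1" "\<pi> 3 \<noteq> 2"
        using map[of 3] inj[of 3 1] inj[of 3 2] p n4 by auto
      then have j: "\<pi> 3 \<in> J" by (auto simp: J_def)
      show False
        using S_swap[OF three_J j, of "2 * k" "2 * k"] e(2,3) p YF(5,7)[OF j] by simp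
    next
      case True
      have "\<pi> 1 \<in> {1,2,3}" "\<pi> 2 \<in> {1,2,3}" "\<pi> 3 \<in> {1,2,3}"
        using map[of 1] map[of 2] map[of 3] True by auto
      moreover have "\<pi> 1 \<noteq> \<pi> 2" "\<pi> 1 \<noteq> \<pi> 3" "\<pi> 2 \<noteq> \<pi> 3" using inj by simp_all
      moreover have "b < S 3 (2 * k)" "S 3 (2 * k) < S 3 (Suc (2 * k))"
        using S_gt_b[OF three_J, of "2 * k"] S_mono[OF three_J] k1 by simp_all
      moreover note YF(3,4) YF(5-8)[OF three_J]
      ultimately show False using e b2 by (elim insertE emptyE) simp_all
    qed
  qed
qed

text \<open>In X every j in J lies on a 3-cycle 1 -> 2 -> j -> 1 starting with weight b, and Y has
  just one such cycle; so all of J goes to n. An isomorphism then contradicts monotonicity, and a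
  reversal needs n = 4 and is refuted by \<open>TS_match\<close>.\<close>

lemma capped_not_chain:
  assumes sim: "similar V X Y" and X: "capped X e" and Y: "chain Y r"
  shows False
proof -
  note XF = forkD[OF cappedD(1)[OF X]]
  have p: "b > 0" using b2 by simp
  have Sp: "S j (2 * k) > 0" "S j (Suc (2 * k)) > 0" if "j \<in> J" for j using S_pos[OF that] k1 by simp_all
  have YD: "Y 2 n = T (2 * k)" "Y n 1 = T (Suc (2 * k))" using Y unfolding chain_def by auto
  note mem = V_mem(1-3)
  have five: "n = 4" if inj: "inj \<pi>" and "\<And>j. j \<in> J \<Longrightarrow> \<pi> j = n" for \<pi> :: "nat \<Rightarrow> nat"
  proof (rule ccontr)
    assume "n \<noteq> 4"
    then have "4 \<in> J" using n4 by (simp add: J_def)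
    then have "\<pi> 4 = \<pi> 3" using that(2) three_J by simp
    then show False using injD[OF inj, of 4 3] by simp
  qed
  from sim show False
  proof (cases rule: similarE)
    case (1 \<pi>)
    note eq = iso_by_eq[OF 1] and map = iso_by_mem[OF 1]
    have c: "\<pi> 1 = 1 \<and> \<pi> 2 = 2 \<and> \<pi> j = n" if j: "j \<in> J" for j
      using chain_cycle[OF Y map[OF mem(1)] map[OF mem(2)] map[OF V_mem(4)[OF j]]]
        eq[OF mem(1,2)] eq[OF mem(2) V_mem(4)[OF j]] eq[OF V_mem(4)[OF j] mem(1)]
        XF(3) XF(5,7)[OF j] Sp[OF j] p by simp
    have "T (2 * k) = S 3 (Suc (2 * k))" "T (Suc (2 * k)) = S 3 (2 * k)"
      using eq[OF mem(2) V_mem(4)[OF three_J]] eq[OF V_mem(4)[OF three_J] mem(1)]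
        c[OF three_J] YD XF(5,7)[OF three_J] by simp_all
    then show False using T_mono[of "2 * k" "Suc (2 * k)"] S_mono[OF three_J, of "2 * k" "Suc (2 * k)"] by simp
  next
    case (2 \<pi>)
    have eq: "Y (\<pi> i) (\<pi> j) = X j i" if "i \<in> V" "j \<in> V" for i j using iso_by_eq[OF 2 that] by simp
    note map = iso_by_mem[OF 2]
    have c: "\<pi> 2 = 1 \<and> \<pi> 1 = 2 \<and> \<pi> j = n" if j: "j \<in> J" for j
      using chain_cycle[OF Y map[OF mem(2)] map[OF mem(1)] map[OF V_mem(4)[OF j]]]
        eq[OF mem(2,1)] eq[OF mem(1) V_mem(4)[OF j]] eq[OF V_mem(4)[OF j] mem(2)]
        XF(3) XF(5,7)[OF j] Sp[OF j] p by simp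
    have "n = 4" using five[OF permutes_inj[OF iso_by_permutes[OF 2]]] c by blast
    moreover have "T (2 * k) = S 3 (2 * k)" "T (Suc (2 * k)) = S 3 (Suc (2 * k))"
      using eq[OF mem(1) V_mem(4)[OF three_J]] eq[OF V_mem(4)[OF three_J] mem(2)]
        c[OF three_J] YD XF(5,7)[OF three_J] by simp_all
    ultimately show False using TS_match by blast
  qed
qed

section \<open>Assembling the cases\<close>

definition outer_stage :: "quiver \<Rightarrow> nat \<Rightarrow> bool" where
  "outer_stage X m \<longleftrightarrow> m = 0 \<and> capped X (- 1) \<or> m = 1 \<and> capped X 1 \<or> (\<exists>r. m = 2 * k + 1 + r \<and> chain X r)"

definition inner_stage :: "quiver \<Rightarrow> nat \<Rightarrow> bool" where
  "inner_stage X m \<longleftrightarrow>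
     (\<exists>y. m = Suc y \<and> rim_a X y) \<or> (\<exists>y. m + y = 4 * k + n - 2 \<and> rim_A X y) \<or>
     m = 2 * k + n - 1 \<and> turn X \<or> m = 2 * k + n \<and> lead X \<or>
     m = 4 * k + n - 2 \<and> late X \<or> m = 4 * k + n - 2 \<and> short X \<or> m = 4 * k + n - 1 \<and> closing X"

lemma quiver_at_stage:
  assumes Q: "capped Q (- 1)" and m: "m \<le> n + 4 * k - 1"
  shows "outer_stage (quiver_at n k Q m) m \<or> inner_stage (quiver_at n k Q m) m"
proof -
  let ?X = "quiver_at n k Q m"
  \<comment> \<open>For k = 1 the positions \<open>2 * k + n\<close> and
    \<open>4 * k + n - 2\<close> coincide and are left to the later case, hence \<open>k > 1\<close>
    in the earlier one.\<close>
  consider "m = 0" | "m = 1" | "2 \<le> m" "m \<le> 2 * k" | "2 * k + 1 \<le> m" "m \<le> 2 * k + n - 2"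
    | "m = 2 * k + n - 1" | "m = 2 * k + n" "k > 1"
    | "2 * k + n < m" "m < 4 * k + n - 2" | "m = 4 * k + n - 2" | "m = 4 * k + n - 1"
  proof (cases "m \<le> 2 * k")
    case True
    then show ?thesis using that(1-3) by linarith
  next
    case False
    note low = this
    show ?thesis
    proof (cases "m < 2 * k + n")
      case True
      then have "m \<le> 2 * k + n - 2 \<or> m = 2 * k + n - 1" by linarith
      then show ?thesis using that(4,5) low by auto
    next
      case False
      then have "m < 4 * k + n - 2 \<or> m = 4 * k + n - 2 \<or> m = 4 * k + n - 1" using m by linarith
      moreover have "m = 2 * k + n \<or> 2 * k + n < m" using False by linarith
      ultimately show ?thesis using that(6-9) by force
    qed
  qed
  then show ?thesis
  proof cases
    case 1
    then show ?thesis using Q unfolding outer_stage_def by (simp add: quiver_at_0)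
  next
    case 2
    have "?X = mutate n Q"
      using quiver_at_Suc[of 0 n k Q] n4 2 by (simp add: quiver_at_0 vertex_seq_nth(1))
    then show ?thesis using capped_mutate[OF Q] 2 unfolding outer_stage_def by simp
  next
    case 3
    then obtain t where t: "m = Suc t" "1 \<le> t" "t < 2 * k" by (cases m) auto
    have "1 \<le> 2 * k - t" using t by simp
    then have "rim_a ?X t" using quiver_at_first[OF Q, of t] t unfolding rim_a_def by (metis less_imp_le)
    then show ?thesis using t unfolding inner_stage_def by blast
  next
    case 4
    then obtain r where "m = 2 * k + 1 + r" using le_Suc_ex by blast
    moreover from this 4 have "r \<le> n - 3" by simp
    ultimately show ?thesis using quiver_at_chain[OF Q] unfolding outer_stage_def by blast
  next
    case 5
    then show ?thesis using quiver_at_turn[OF Q] unfolding inner_stage_def by blast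
  next
    case 6
    then have "lead ?X" using quiver_at_second[OF Q, of 0] unfolding lead_def by simp
    then show ?thesis using 6 unfolding inner_stage_def by blast
  next
    case 7
    then obtain x where x: "m = 2 * k + n + x" using le_Suc_ex less_imp_le by blast
    have "x \<ge> 1" "x \<le> 2 * k - 2" "2 * k - 2 - x \<ge> 1" "m + (2 * k - 2 - x) = 4 * k + n - 2"
      using x 7 by simp_all
    moreover from this have "rim_A ?X (2 * k - 2 - x)"
      using quiver_at_second[OF Q, of x] x unfolding rim_A_def by blast
    ultimately show ?thesis unfolding inner_stage_def by blast
  next
    case 8
    have m: "m = 2 * k + n + (2 * k - 2)" using 8 k1 by simp
    have sp: "spiral ?X 1 2 (2 * k - 2) 0 (\<lambda>j. - A j)"
      using quiver_at_second[OF Q, of "2 * k - 2"] m by simp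
    show ?thesis
    proof (cases "k = 1")
      case True
      then have "short ?X" using sp unfolding short_def by simp
      then show ?thesis using 8 unfolding inner_stage_def by blast
    next
      case False
      then have "late ?X" using sp k1 unfolding late_def by simp
      then show ?thesis using 8 unfolding inner_stage_def by blast
    qed
  next
    case 9
    then show ?thesis using quiver_at_closing[OF Q] unfolding inner_stage_def by blast
  qed
qed

lemma inner_stage_all_inner:
  assumes "inner_stage X m" "v \<in> V"
  shows "inner_vertex V X v"
proof -
  have hub: "inner_vertex V X v" if "weighted_hub X z" for z
    using that hub_inner_vertex[OF _ _ assms(2)] n4 unfolding weighted_hub_def by fastforce
  have tri: "inner_vertex V X v" if "tri V X u B C" for u B C
    using tri_inner_vertex[OF that assms(2)] .
  consider y where "rim_a X y \<or> rim_A X y" | "turn X" | "lead X" | "late X" | "short X" | "closing X"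
    using assms(1) unfolding inner_stage_def by blast
  then show ?thesis
  proof cases
    case (1 y) show ?thesis by (rule hub[OF rim_weighted_hub[OF 1]])
  next
    case 2 show ?thesis by (rule hub[OF turn_weighted_hub[OF 2]])
  next
    case 3 show ?thesis by (rule hub[OF lead_weighted_hub[OF 3]])
  next
    case 4 then show ?thesis using tri[OF late_tri] unfolding late_def by blast
  next
    case 5 then show ?thesis using tri[OF short_tri] unfolding short_def by blast
  next
    case 6 show ?thesis by (rule tri[OF closing_tri[OF 6]])
  qed
qed

lemma outer_stage_not_inner:
  assumes "outer_stage X m"
  shows "\<exists>v\<in>V. \<not> inner_vertex V X v"
proof -
  have "\<not> inner_vertex V X n" if "capped X (- 1) \<or> capped X 1"
    using that capped_not_inner[of X "- 1"] capped_not_inner[of X 1] by blast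
  moreover have "n \<in> V" by (rule V_mem(3))
  moreover have "(capped X (- 1) \<or> capped X 1) \<or> (\<exists>r. chain X r)"
    using assms unfolding outer_stage_def by blast
  ultimately show ?thesis using chain_not_inner by blast
qed

lemma outer_stage_index:
  assumes "similar V X Y" "outer_stage X l" "outer_stage Y m"
  shows "l = m"
proof -
  note sym = similar_sym[OF assms(1)]
  have X: "l = 0 \<and> capped X (- 1) \<or> l = 1 \<and> capped X 1 \<or> (\<exists>r. l = 2 * k + 1 + r \<and> chain X r)"
    and Y: "m = 0 \<and> capped Y (- 1) \<or> m = 1 \<and> capped Y 1 \<or> (\<exists>r. m = 2 * k + 1 + r \<and> chain Y r)"
    using assms(2,3) unfolding outer_stage_def by blast+
  show ?thesis
    using X Y capped_distinct[OF assms(1)] capped_distinct[OF sym] capped_not_chain[OF assms(1)]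
      capped_not_chain[OF sym] chain_index[OF assms(1)] by metis
qed

text \<open>Since similarity is symmetric, numbering the kinds of quivers halves the number of pairs that
  have to be compared.\<close>
definition kind :: "quiver \<Rightarrow> nat \<Rightarrow> nat \<Rightarrow> bool" where
  "kind X m i \<longleftrightarrow>
     i = 0 \<and> (\<exists>y. m = Suc y \<and> rim_a X y) \<or>
     i = 1 \<and> (\<exists>y. m + y = 4 * k + n - 2 \<and> rim_A X y) \<or>
     i = 2 \<and> m = 2 * k + n - 1 \<and> turn X \<or> i = 3 \<and> m = 2 * k + n \<and> lead X \<or>
     i = 4 \<and> m = 4 * k + n - 2 \<and> late X \<or> i = 5 \<and> m = 4 * k + n - 2 \<and> short X \<or>
     i = 6 \<and> m = 4 * k + n - 1 \<and> closing X"

lemma kind_index: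
  assumes sim: "similar V X Y" and X: "kind X l i" and Y: "kind Y m j" and "i \<le> j"
  shows "l = m"
proof -
  have k: "lead Z \<Longrightarrow> k > 1" "late Z \<Longrightarrow> k > 1" "short Z \<Longrightarrow> k = 1" for Z
    unfolding lead_def late_def short_def by blast+
  consider (a) y where "i = 0" "l = Suc y" "rim_a X y" | (b) y where "i = 1" "l + y = 4 * k + n - 2" "rim_A X y"
    | (c) "i = 2" "l = 2 * k + n - 1" "turn X" | (d) "i = 3" "l = 2 * k + n" "lead X"
    | (e) "i = 4" "l = 4 * k + n - 2" "late X" | (f) "i = 5" "l = 4 * k + n - 2" "short X"
    | (g) "i = 6" "l = 4 * k + n - 1" "closing X"
    using X unfolding kind_def by blast
  note Xc = this
  consider (a) y where "j = 0" "m = Suc y" "rim_a Y y" | (b) y where "j = 1" "m + y = 4 * k + n - 2" "rim_A Y y"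
    | (c) "j = 2" "m = 2 * k + n - 1" "turn Y" | (d) "j = 3" "m = 2 * k + n" "lead Y"
    | (e) "j = 4" "m = 4 * k + n - 2" "late Y" | (f) "j = 5" "m = 4 * k + n - 2" "short Y"
    | (g) "j = 6" "m = 4 * k + n - 1" "closing Y"
    using Y unfolding kind_def by blast
  note Yc = this
  \<comment> \<open>Every other kind has a wide decomposition or a hub heavier than b, so only rim
    quivers can resemble rim quivers.\<close>
  have rim: "j \<le> 1" if "rim_a X y \<or> rim_A X y" for y
    using Yc
  proof cases
    case c then show ?thesis using rim_not_turn[OF sim that] by blast
  next
    case d then show ?thesis using rim_not_turn[OF sim that] by blast
  next
    case e then show ?thesis using rim_not_late[OF sim that] by blast
  next
    case f then show ?thesis using rim_not_late[OF sim that] by blast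
  next
    case g then show ?thesis using rim_not_late[OF sim that] by blast
  qed simp_all
  from Xc show ?thesis
  proof cases
    case (a y)
    have "j \<le> 1" using rim a(3) by blast
    from Yc show ?thesis
    proof cases
      case (a y')
      then show ?thesis using rim_a_index[OF sim \<open>rim_a X y\<close>] \<open>l = Suc y\<close> by simp
    next
      case (b y')
      then show ?thesis using rim_a_not_rim_A[OF sim \<open>rim_a X y\<close>] by blast
    qed (use \<open>j \<le> 1\<close> in simp_all)
  next
    case (b y)
    have "j \<le> 1" using rim b(3) by blast
    from Yc show ?thesis
    proof cases
      case (b y')
      then show ?thesis using rim_A_index[OF sim \<open>rim_A X y\<close>] \<open>l + y = _\<close> by simp
    qed (use \<open>j \<le> 1\<close> \<open>i = 1\<close> \<open>i \<le> j\<close> in simp_all)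
  next
    case Xt: c
    from Yc show ?thesis
    proof cases
      case d then show ?thesis using turn_not_lead[OF sim Xt(3)] by blast
    next
      case e then show ?thesis using turn_not_closing[OF sim] Xt(3) by blast
    next
      case f then show ?thesis using turn_not_short[OF sim Xt(3)] by blast
    next
      case g then show ?thesis using turn_not_closing[OF sim] Xt(3) by blast
    qed (use Xt \<open>i \<le> j\<close> in simp_all)
  next
    case Xl: d
    from Yc show ?thesis
    proof cases
      case e then show ?thesis using turn_not_closing[OF sim] Xl(3) by blast
    next
      \<comment> \<open>\<open>lead\<close> and \<open>short\<close> belong to different values of
        k.\<close>
      case f then show ?thesis using k(1)[OF Xl(3)] k(3)[OF f(3)] by simp
    next
      case g then show ?thesis using turn_not_closing[OF sim] Xl(3) by blast
    qed (use Xl \<open>i \<le> j\<close> in simp_all)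
  next
    case Xl: e
    from Yc show ?thesis
    proof cases
      case g then show ?thesis using late_not_closing[OF sim Xl(3)] by blast
    qed (use Xl \<open>i \<le> j\<close> in simp_all)
  next
    case Xs: f
    from Yc show ?thesis
    proof cases
      case g then show ?thesis using short_not_closing[OF sim Xs(3)] by blast
    qed (use Xs \<open>i \<le> j\<close> in simp_all)
  next
    case Xe: g
    from Yc show ?thesis by cases (use Xe \<open>i \<le> j\<close> in simp_all)
  qed
qed

lemma stage_index:
  assumes sim: "similar V X Y"
    and X: "outer_stage X l \<or> inner_stage X l" and Y: "outer_stage Y m \<or> inner_stage Y m"
  shows "l = m"
proof -
  have kind: "\<exists>i. kind Z m i" if "inner_stage Z m" for Z m
    using that unfolding inner_stage_def kind_def by (simp add: ex_disj_distrib)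
  have mixed: False if "similar V X Y" "outer_stage X l" "inner_stage Y m" for X Y l m
    using similar_inner_vertices[OF that(1)] inner_stage_all_inner[OF that(3)]
      outer_stage_not_inner[OF that(2)] by blast
  show ?thesis
  proof (cases "outer_stage X l")
    case True
    then show ?thesis using Y outer_stage_index[OF sim] mixed[OF sim] by blast
  next
    case False
    then have "inner_stage X l" "inner_stage Y m" using X Y mixed[OF similar_sym[OF sim]] by blast+
    then obtain i j where ij: "kind X l i" "kind Y m j" using kind by blast
    show ?thesis
      using kind_index[OF sim ij] kind_index[OF similar_sym[OF sim] ij(2,1)] nat_le_linear[of i j] by auto
  qed
qed

end

theorem theorem5p3:
  fixes n k :: nat and Rt Q R :: quiver
  assumes "n \<ge> 4" and "k > 0"
    and "quiver_on {1..n-1} Rt"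
    and "\<And>i j. 1 \<le> i \<Longrightarrow> i < j \<Longrightarrow> j \<le> n - 1 \<Longrightarrow> Rt i j \<ge> 2"
    and "quiver_on {1..n} Q"
    and "full_subquiver {1..n-1} Q = mutate_seq (concat (replicate k [2, 1])) Rt"
    and "\<And>i. 1 \<le> i \<Longrightarrow> i \<le> n - 1 \<Longrightarrow> Q i n \<ge> 2"
    and "R = quiver_at n k Q (2 * k + 1)"
    and "n \<ge> 5 \<or> (n = 4 \<and> Q 1 4 \<noteq> R 2 3)"
  shows "\<forall>l m. l < m \<and> m \<le> n + 4 * k - 1 \<longrightarrow>
           \<not> isomorphic_on {1..n} (quiver_at n k Q l) (quiver_at n k Q m) \<and>
           \<not> isomorphic_on {1..n} (quiver_at n k Q l) (reverse_arrows (quiver_at n k Q m))"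
proof -
  have skR: "skew Rt" and skQ: "skew Q" using assms(3,5) quiver_on_skew by blast+
  interpret cycle_data n k "Rt 1 2" "Rt 1" "Rt 2" "\<lambda>i. Q i n" Rt
  proof
    show "n \<ge> 4" "k \<ge> 1" "skew Rt" using assms(1,2) skR by simp_all
    show "Rt 1 2 \<ge> 2" using assms(4)[of 1 2] assms(1) by simp
    show "Rt 1 j \<ge> 2" "Rt 2 j \<ge> 2" if "j \<in> {3..<n}" for j
      using assms(4)[of 1 j] assms(4)[of 2 j] that by auto
    show "Q i n \<ge> 2" if "i \<in> {1..<n}" for i using assms(7)[of i] that by auto
    show "Rt i j \<ge> 2" if "3 \<le> i" "i < j" "j < n" for i j using assms(4)[of i j] that by auto
  qed
  \<comment> \<open>The \<open>2 * k\<close> mutations in the hypothesis on Q raise x from 0 to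
    \<open>2 * k\<close>.\<close>
  have "fork Rt 1 2 0"
    unfolding fork_def S_0 S_1 using skR skewD[OF skR, of _ 1] by simp
  from fork_sequence[OF this, of k] have sub: "fork (full_subquiver {1..n-1} Q) 1 2 (2 * k)"
    using assms(6) by simp
  have eq: "full_subquiver {1..n-1} Q i j = Q i j" if "i \<in> {1..<n}" "j \<in> {1..<n}" for i j
    using that by (auto simp: full_subquiver_def)
  have m: "1 \<in> {1..<n}" "2 \<in> {1..<n}" "\<And>j. j \<in> J \<Longrightarrow> j \<in> {1..<n}" using n4 by (auto simp: J_def)
  have "fork Q 1 2 (2 * k)"
    using sub skQ eq[OF m(1,2)] eq[OF m(3) m(1)] eq[OF m(2) m(3)] eq[OF m(3) m(3)]
    unfolding fork_def by simp
  then have Q: "capped Q (- 1)"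
    unfolding capped_def using skewD[OF skQ, of n] by simp
  \<comment> \<open>R ends the first half, where x is back at 0; its entry is therefore
    \<open>S 3 (Suc 0)\<close>.\<close>
  have R23: "R 2 3 = Rt 2 3" if "n = 4"
  proof -
    have "spiral R 1 2 0 (2 * k) (\<lambda>i. Q i n)"
      using quiver_at_first[OF Q, of "2 * k"] assms(8) by simp
    from forkD(7)[OF spiralD(1)[OF this] three_J] show ?thesis unfolding S_1 .
  qed
  \<comment> \<open>Possible only now, since the translation of the condition on R rests on the
    explicit description of the sequence; this is why there are two locales.\<close>
  interpret generic_cycle_data n k "Rt 1 2" "Rt 1" "Rt 2" "\<lambda>i. Q i n" Rt
    by unfold_locales (use assms(9) R23 in simp)
  have sk: "skew (quiver_at n k Q m)" if "m \<le> n + 4 * k" for m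
    using that
  proof (induction m)
    case (Suc m)
    then show ?case using quiver_at_Suc[of m n k Q] n4 skew_mutate by simp
  qed (simp add: quiver_at_0 skQ)
  show ?thesis
  proof (intro allI impI)
    fix l m assume lm: "l < m \<and> m \<le> n + 4 * k - 1"
    have "\<not> similar {1..n} (quiver_at n k Q l) (quiver_at n k Q m)"
      using stage_index[OF _ quiver_at_stage[OF Q] quiver_at_stage[OF Q], of l m] lm by auto
    then show "\<not> isomorphic_on {1..n} (quiver_at n k Q l) (quiver_at n k Q m) \<and>
        \<not> isomorphic_on {1..n} (quiver_at n k Q l) (reverse_arrows (quiver_at n k Q m))"
      using similar_if_isomorphic_on[OF sk] lm by auto
  qed
qed

end
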